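(* Let $p$ be a prime, let $q\in\mathbb{C}_p$ with $q\neq 1$ and $|1-q|<p^{-\frac{1}{p-1}}$, and let $P(x)\in\mathbb{C}_p[[x]_q]$, i.e. $P$ is an arbitrary polynomial in $[x]_q$ with coefficients in $\mathbb{C}_p$, regarded as a function of $x\in\mathbb{Z}_p$. Then $\mu_{P,q}$ is a strongly $p$-adic $q$-invariant distribution on $\mathbb{Z}_p$, and for all $x\in\mathbb{Z}_p$, $$f_{\mu_{P,q}}(x)=P(x).$$ Furthermore, for any $g\in C^{(1)}(\mathbb{Z}_p,\mathbb{C}_p)$, $$\int_{\mathbb{Z}_p}g(x)\,d\mu_{P,q}(x)=\int_{\mathbb{Z}_p}g(x)P(x)q^{-x}\,d\mu_q(x),$$ where the second integral is the $q$-Volkenborn integral.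
   Context: $\mathbb{C}_p$ is the completion of an algebraic closure of $\mathbb{Q}_p$, with absolute value normalized by $|p|=p^{-1}$. For $x\in\mathbb{Z}_p$, $[x]_q=\frac{1-q^x}{1-q}$. $C^{(1)}(\mathbb{Z}_p,\mathbb{C}_p)$ is the space of $C^{(1)}$-functions $f:\mathbb{Z}_p\to\mathbb{C}_p$, i.e. those for which the difference quotient $\Delta_1 f(m,x)=\frac{f(x+m)-f(x)}{m}$ ($x,m\in\mathbb{Z}_p$, $m\ne0$) extends to a continuous function on $\mathbb{Z}_p\times\mathbb{Z}_p$. The $q$-Volkenborn integral of $h\in C^{(1)}(\mathbb{Z}_p,\mathbb{C}_p)$ is $$\int_{\mathbb{Z}_p}h(x)\,d\mu_q(x)=\lim_{N\to\infty}\frac{1}{[p^N]_q}\sum_{x=0}^{p^N-1}h(x)q^x ;$$ here $\mu_q(a+p^N\mathbb{Z}_p)=\frac{q^a}{[p^N]_q}$ for $0\le a<p^N$. A distribution on $\mathbb{Z}_p$ is a finitely additive $\mathbb{C}_p$-valued function on the compact open subsets of $\mathbb{Z}_p$. A distribution $\mu$ is called a strongly $p$-adic $q$-invariant distribution if there is a positive real constant $c$ such that $$\left|[p^n]_q\,\mu(a+p^n\mathbb{Z}_p)-[p^{n+1}]_q\,\mu(a+p^{n+1}\mathbb{Z}_p)\right|\le c\,p^{-n}$$ for all $a\in\mathbb{Z}$ and all positive integers $n$ ($c$ independent of $a$ and $n$). For such $\mu$ the Radon-Nikodym derivative is $f_{\mu}(x)=\lim_{N\to\infty}[p^N]_q\,\mu(x+p^N\mathbb{Z}_p)$,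 $x\in\mathbb{Z}_p$, and the integral of a function $g$ on $\mathbb{Z}_p$ with respect to $\mu$ is $$\int_{\mathbb{Z}_p}g(x)\,d\mu(x)=\lim_{N\to\infty}\sum_{x=0}^{p^N-1}g(x)\,\mu(x+p^N\mathbb{Z}_p),$$ if the limit exists. For $f\in C^{(1)}(\mathbb{Z}_p,\mathbb{C}_p)$, a positive integer $n$ and an integer $0\le a<p^n$, define $$\mu_{f,q}(a+p^n\mathbb{Z}_p)=\lim_{m\to\infty}\frac{1}{[p^m]_q}\sum_{x=0}^{p^{m-n}-1}f(a+p^n x)$$ (the $q$-Volkenborn integral over $a+p^n\mathbb{Z}_p$ of $y\mapsto q^{-y}f(y)$); $\mu_{P,q}$ is the case $f=P$. *)

theory Defs
  imports "HOL-Analysis.Analysis" "HOL-Computational_Algebra.Polynomial"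
begin

text \<open>Fields with a non-archimedean absolute value, as metric spaces. The library constrains
  its \<open>norm\<close> to real normed vector spaces, which excludes p-adic fields, so the absolute value is a
  class parameter of its own.\<close>

class ultrametric_field = field_char_0 + metric_space +
  fixes absval :: "'a \<Rightarrow> real"
  assumes dist_absval: "dist x y = absval (x - y)"
    and absval_mult: "absval (x * y) = absval x * absval y"
    and absval_add_le_max: "absval (x + y) \<le> max (absval x) (absval y)"

text \<open>In a complete \<^class>\<open>ultrametric_field\<close> with \<open>|p| = 1/p\<close>, the absolute value
  restricts to the p-adic one on the rationals (Bezout), so their closure is a completion of the
  rationals for the p-adic absolute value.\<close>

definition Qp :: "'k::ultrametric_field set" where
  "Qp = closure \<rat>"

definition Qp_bar :: "'k::ultrametric_field set" where
  "Qp_bar = {x. \<exists>r. r \<noteq> 0 \<and> (\<forall>i. coeff r i \<in> Qp) \<and> poly r x = 0}"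

text \<open>The type \<open>'k\<close> is a completion of an algebraic closure of the p-adic numbers, with the
  normalised absolute value. Such a field is unique up to isometric isomorphism.
  Completeness is the sort constraint \<^class>\<open>complete_space\<close>.\<close>

definition is_Cp :: "nat \<Rightarrow> 'k::{ultrametric_field, complete_space} itself \<Rightarrow> bool" where
  "is_Cp p K \<longleftrightarrow>
     absval (of_nat p :: 'k) = 1 / real p \<and>
     (\<forall>r::'k poly. (\<forall>i. coeff r i \<in> Qp_bar) \<and> degree r > 0 \<longrightarrow> (\<exists>x\<in>Qp_bar. poly r x = 0)) \<and>
     closure (Qp_bar :: 'k set) = UNIV"

definition Zp :: "'k::ultrametric_field set" where
  "Zp = {x \<in> Qp. absval x \<le> 1}"

text \<open>The coset \<open>a + p^n Z_p\<close>.\<close>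

definition coset_Zp :: "nat \<Rightarrow> 'k::ultrametric_field \<Rightarrow> nat \<Rightarrow> 'k set" where
  "coset_Zp p a n = (\<lambda>z. a + of_nat p ^ n * z) ` Zp"

text \<open>For \<open>|1 - q| < 1\<close> and a p-adic integer \<open>x\<close>, the power \<open>q^x\<close> is given by the binomial series
  \<open>(1 + (q - 1))^x\<close>; this is the unique continuous function of \<open>x\<close> on the p-adic integers that
  extends the ordinary powers, and coincides with \<open>exp (x log q)\<close> when \<open>|1 - q| < p^(-1/(p-1))\<close>.\<close>

definition qpow :: "'k::ultrametric_field \<Rightarrow> 'k \<Rightarrow> 'k" where
  "qpow q x = (\<Sum>n. (x gchoose n) * (q - 1) ^ n)"

lemma qpow_of_nat: "qpow q (of_nat n) = q ^ n"
proof -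
  have "qpow q (of_nat n) = (\<Sum>k\<le>n. (of_nat n gchoose k) * (q - 1) ^ k)"
    unfolding qpow_def
    by (rule suminf_finite) (auto simp: binomial_gbinomial [symmetric] binomial_eq_0)
  also have "\<dots> = ((q - 1) + 1) ^ n"
    by (subst binomial_ring) (simp add: binomial_gbinomial)
  finally show ?thesis by simp
qed

definition qnum :: "'k::ultrametric_field \<Rightarrow> 'k \<Rightarrow> 'k" where
  "qnum q x = (1 - qpow q x) / (1 - q)"

text \<open>Functions on the p-adic integers are functions on \<open>'k\<close> of which only the values on
  \<^term>\<open>Zp\<close> matter.\<close>

definition C1_Zp :: "('k::ultrametric_field \<Rightarrow> 'k) set" where
  "C1_Zp = {f. \<exists>F :: 'k \<times> 'k \<Rightarrow> 'k. continuous_on (Zp \<times> Zp) F \<and>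
     (\<forall>m\<in>Zp. \<forall>x\<in>Zp. m \<noteq> 0 \<longrightarrow> F (m, x) = (f (x + m) - f x) / m)}"

definition has_qVolkenborn_integral ::
    "nat \<Rightarrow> 'k::ultrametric_field \<Rightarrow> ('k \<Rightarrow> 'k) \<Rightarrow> 'k \<Rightarrow> bool" where
  "has_qVolkenborn_integral p q h I \<longleftrightarrow>
     h \<in> C1_Zp \<and>
     (\<lambda>N. 1 / qnum q (of_nat (p ^ N)) * (\<Sum>x<p ^ N. h (of_nat x) * q ^ x)) \<longlonglongrightarrow> I"

definition compact_opens_Zp :: "'k::ultrametric_field set set" where
  "compact_opens_Zp = {U. compact U \<and> openin (top_of_set Zp) U}"

text \<open>A distribution is a function on \<^term>\<open>compact_opens_Zp\<close>, hence \<^term>\<open>extensional\<close>: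
  this makes two distributions equal as soon as they agree there.\<close>

definition distribution_Zp :: "('k::ultrametric_field set \<Rightarrow> 'k) \<Rightarrow> bool" where
  "distribution_Zp \<mu> \<longleftrightarrow>
     \<mu> \<in> extensional compact_opens_Zp \<and>
     (\<forall>U\<in>compact_opens_Zp. \<forall>V\<in>compact_opens_Zp. U \<inter> V = {} \<longrightarrow> \<mu> (U \<union> V) = \<mu> U + \<mu> V)"

definition strongly_q_invariant ::
    "nat \<Rightarrow> 'k::ultrametric_field \<Rightarrow> ('k set \<Rightarrow> 'k) \<Rightarrow> bool" where
  "strongly_q_invariant p q \<mu> \<longleftrightarrow>
     distribution_Zp \<mu> \<and>
     (\<exists>c>0. \<forall>a::int. \<forall>n>0.
        absval (qnum q (of_nat (p ^ n)) * \<mu> (coset_Zp p (of_int a) n)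
            - qnum q (of_nat (p ^ (n + 1))) * \<mu> (coset_Zp p (of_int a) (n + 1)))
          \<le> c * real p powr (- real n))"

definition has_RN_derivative ::
    "nat \<Rightarrow> 'k::ultrametric_field \<Rightarrow> ('k set \<Rightarrow> 'k) \<Rightarrow> 'k \<Rightarrow> 'k \<Rightarrow> bool" where
  "has_RN_derivative p q \<mu> x y \<longleftrightarrow>
     (\<lambda>N. qnum q (of_nat (p ^ N)) * \<mu> (coset_Zp p x N)) \<longlonglongrightarrow> y"

definition has_distr_integral ::
    "nat \<Rightarrow> ('k::ultrametric_field set \<Rightarrow> 'k) \<Rightarrow> ('k \<Rightarrow> 'k) \<Rightarrow> 'k \<Rightarrow> bool" where
  "has_distr_integral p \<mu> g I \<longleftrightarrow>
     (\<lambda>N. \<Sum>x<p ^ N. g (of_nat x) * \<mu> (coset_Zp p (of_nat x) N)) \<longlonglongrightarrow> I"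

text \<open>The values of \<open>\<mu>_{f,q}\<close> are prescribed as limits on cosets; on the remaining compact
  open sets they are determined by finite additivity. \<open>mu_fq\<close> is
  meaningful only where \<open>is_mu_fq\<close> has a unique solution. For \<open>m < n\<close> the exponent \<open>m - n\<close> is truncated, which
  does not affect the limit.\<close>

definition is_mu_fq ::
    "nat \<Rightarrow> 'k::ultrametric_field \<Rightarrow> ('k \<Rightarrow> 'k) \<Rightarrow> ('k set \<Rightarrow> 'k) \<Rightarrow> bool" where
  "is_mu_fq p q f \<mu> \<longleftrightarrow>
     distribution_Zp \<mu> \<and>
     (\<forall>n>0. \<forall>a<p ^ n.
        (\<lambda>m. 1 / qnum q (of_nat (p ^ m)) * (\<Sum>x<p ^ (m - n). f (of_nat (a + p ^ n * x))))
          \<longlonglongrightarrow> \<mu> (coset_Zp p (of_nat a) n))"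

definition mu_fq ::
    "nat \<Rightarrow> 'k::ultrametric_field \<Rightarrow> ('k \<Rightarrow> 'k) \<Rightarrow> 'k set \<Rightarrow> 'k" where
  "mu_fq p q f = (THE \<mu>. is_mu_fq p q f \<mu>)"

end

theory Submission
  imports Defs
begin

text \<open>
  Expanding a polynomial in \<open>[x]_q = (1 - q^x)/(1 - q)\<close> shows that \<open>P\<close> is a finite combination
  \<open>\<Sum>k\<le>d. c\<^sub>k q^(k x)\<close>, and everything rests on the geometric sums
  \<open>s\<^sub>k(n) = \<Sum>x<p^n. q^(k x)\<close> (written \<open>geo (q^k) n\<close>; note \<open>s\<^sub>1(n) = [p^n]_q\<close>). The exponent \<open>k = 0\<close>
  needs no separate treatment and no logarithm, because \<open>k\<close> is never divided by.

  \<^item> The hypothesis on \<open>|1 - q|\<close> says \<open>|q - 1|^(p-1) < |p|\<close>. It makes the term \<open>p u\<close> dominate in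
    \<open>(1 + u)^p - 1\<close> for \<open>u = q^k - 1\<close>, hence \<open>|s\<^sub>k(n)| = p^(-n)\<close> for every \<open>k\<close> (\<open>absval_geo\<close>).
  \<^item> Therefore the quotients \<open>s\<^sub>k(n)/s\<^sub>1(n)\<close> have absolute value 1, consecutive ones differ by
    \<open>O(p^(-n))\<close> (\<open>ratio_step\<close>), and they converge to a number \<open>H\<^sub>k\<close> at that rate.
  \<^item> Splitting \<open>s\<^sub>k(m)\<close> by residues modulo \<open>p^n\<close> gives the limit that prescribes the distribution:
    \<open>\<mu>(a + p^n Z_p) = \<Sum>k\<le>d. c\<^sub>k q^(k a) H\<^sub>k / s\<^sub>k(n)\<close> for \<open>0 \<le> a < p^n\<close> (\<open>coset_sum_tendsto\<close>).
    Compactness of \<open>Z_p\<close> writes every compact open set as a finite disjoint union of such cosets,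
    which yields existence and uniqueness of the distribution (\<open>is_mu_fq_ex1\<close>).
  \<^item> Multiplying by \<open>[p^n]_q\<close> replaces \<open>H\<^sub>k/s\<^sub>k(n)\<close> by \<open>H\<^sub>k s\<^sub>1(n)/s\<^sub>k(n) = 1 + O(p^(-n))\<close>. Since \<open>P\<close> is
    Lipschitz, \<open>[p^n]_q \<mu>(x + p^n Z_p) = P(x) + O(p^(-n))\<close> uniformly in \<open>x\<close>
    (\<open>mu_fq_density_estimate\<close>). Strong invariance and the Radon-Nikodym derivative are both
    immediate from this estimate.
  \<^item> The estimate alone is too weak for the integrals: a Riemann sum divides by \<open>[p^N]_q\<close>, after which
    an error of size \<open>p^(-N)\<close> is merely bounded. Instead one keeps the \<open>d + 1\<close> exponentials apart: the two
    approximating sums are \<open>\<Sum>k\<le>d. c\<^sub>k V\<^sub>k(N) (H\<^sub>k s\<^sub>1(N)/s\<^sub>k(N))\<close> and \<open>\<Sum>k\<le>d. c\<^sub>k V\<^sub>k(N)\<close> with the same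
    averages \<open>V\<^sub>k(N) = (1/[p^N]_q) \<Sum>x<p^N. g(x) q^(k x)\<close>, and these averages converge because
    \<open>g(x) q^(k x)\<close> is a \<open>C^(1)\<close>-function (\<open>Volkenborn_convergent\<close>, \<open>mu_fq_integral\<close>).
\<close>

section \<open>Ultrametric absolute values and convergence\<close>

lemma absval_zero [simp]: "absval (0::'a::ultrametric_field) = 0"
  using dist_absval[of "0::'a" 0] by simp

lemma absval_eq_0_iff [simp]: "absval (x::'a::ultrametric_field) = 0 \<longleftrightarrow> x = 0"
  by (metis diff_zero dist_absval dist_eq_0_iff)

lemma absval_nonneg [simp]: "0 \<le> absval (x::'a::ultrametric_field)"
  using dist_absval[of x 0] by (metis diff_zero zero_le_dist)

lemma absval_pos_iff [simp]: "0 < absval (x::'a::ultrametric_field) \<longleftrightarrow> x \<noteq> 0"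
  by (metis absval_eq_0_iff absval_nonneg less_le)

lemma absval_one [simp]: "absval (1::'a::ultrametric_field) = 1"
  using absval_mult[of "1::'a" 1] by simp

lemma absval_minus [simp]: "absval (- x) = absval (x::'a::ultrametric_field)"
  by (metis diff_0 diff_zero dist_absval dist_commute)

lemma absval_minus_commute: "absval (x - y) = absval (y - x :: 'a::ultrametric_field)"
  by (metis absval_minus minus_diff_eq)

lemma absval_power: "absval (x ^ n) = absval (x::'a::ultrametric_field) ^ n"
  by (induction n) (auto simp: absval_mult)

lemma absval_inverse: "absval (inverse x) = inverse (absval (x::'a::ultrametric_field))"
proof (cases "x = 0")
  case False
  then have "absval x * absval (inverse x) = 1" by (simp flip: absval_mult)
  then show ?thesis by (metis inverse_unique)
qed simp

lemma absval_divide: "absval (x / y) = absval x / absval (y::'a::ultrametric_field)"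
  by (simp add: divide_inverse absval_mult absval_inverse)

lemma absval_add_le: "absval x \<le> B \<Longrightarrow> absval y \<le> B \<Longrightarrow> absval (x + y :: 'a::ultrametric_field) \<le> B"
  using absval_add_le_max[of x y] by linarith

lemma absval_diff_le: "absval x \<le> B \<Longrightarrow> absval y \<le> B \<Longrightarrow> absval (x - y :: 'a::ultrametric_field) \<le> B"
  using absval_add_le[of x B "- y"] by simp

lemma absval_unit_mult_le:
  assumes "absval x \<le> 1" "absval y \<le> B"
  shows "absval (x * y :: 'a::ultrametric_field) \<le> B"
  using assms mult_left_le_one_le[of "absval y" "absval x"] by (simp add: absval_mult)

lemma absval_triangle: "absval (x + y) \<le> absval x + absval (y :: 'a::ultrametric_field)"
  by (rule absval_add_le) auto

lemma absval_diff_trans: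
  "absval (x - y) \<le> B \<Longrightarrow> absval (y - z) \<le> B \<Longrightarrow> absval (x - z :: 'a::ultrametric_field) \<le> B"
  using absval_add_le[of "x - y" B "y - z"] by simp

lemma absval_sum_le:
  fixes f :: "'b \<Rightarrow> 'a::ultrametric_field"
  assumes "\<And>i. i \<in> A \<Longrightarrow> absval (f i) \<le> B" "0 \<le> B"
  shows "absval (sum f A) \<le> B"
  using assms by (induction A rule: infinite_finite_induct) (auto intro: absval_add_le)

lemma absval_sum_less:
  fixes f :: "'b \<Rightarrow> 'a::ultrametric_field"
  assumes "\<And>i. i \<in> A \<Longrightarrow> absval (f i) < B" "0 < B"
  shows "absval (sum f A) < B"
  using assms
proof (induction A rule: infinite_finite_induct)
  case (insert x F)
  then show ?case by (auto intro!: le_less_trans[OF absval_add_le_max])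
qed auto

lemma absval_sum_triangle:
  fixes f :: "'b \<Rightarrow> 'a::ultrametric_field"
  shows "absval (sum f A) \<le> (\<Sum>i\<in>A. absval (f i))"
  by (induction A rule: infinite_finite_induct) (auto intro: order_trans[OF absval_triangle])

lemma absval_add_dominant:
  fixes x :: "'a::ultrametric_field"
  assumes "absval y < absval x"
  shows "absval (x + y) = absval x"
  using absval_add_le_max[of x y] absval_add_le_max[of "x + y" "- y"] assms by auto

lemma absval_of_nat_le_1 [simp]: "absval (of_nat n :: 'a::ultrametric_field) \<le> 1"
  by (induction n) (auto intro: absval_add_le)

lemma absval_of_int_le_1 [simp]: "absval (of_int n :: 'a::ultrametric_field) \<le> 1"
  by (cases n rule: int_cases2) auto

lemma LIMSEQ_absval_iff:
  "X \<longlonglongrightarrow> (l::'a::ultrametric_field) \<longleftrightarrow> (\<lambda>n. absval (X n - l)) \<longlonglongrightarrow> 0"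
  by (subst tendsto_dist_iff) (simp add: dist_absval)

text \<open>The two instances below make the library's limit and continuity rules for sums and products
  available; those for normed algebras do not apply to a field with a bare absolute value.\<close>

instance ultrametric_field \<subseteq> topological_ab_group_add
proof
  fix a b :: 'a
  have "((\<lambda>x. dist (fst x + snd x) (a + b)) \<longlongrightarrow> 0) (nhds a \<times>\<^sub>F nhds b)"
  proof (rule tendsto_sandwich[OF _ _ tendsto_const])
    show "\<forall>\<^sub>F x in nhds a \<times>\<^sub>F nhds b. 0 \<le> dist (fst x + snd x) (a + b)" by simp
    show "\<forall>\<^sub>F x in nhds a \<times>\<^sub>F nhds b. dist (fst x + snd x) (a + b) \<le> dist (fst x) a + dist (snd x) b"
      using absval_triangle[of "fst x - a" "snd x - b" for x :: "'a \<times> 'a"]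
      by (auto simp: dist_absval algebra_simps)
    have "((\<lambda>x. dist (fst x) a + dist (snd x) b) \<longlongrightarrow> dist a a + dist b b) (nhds a \<times>\<^sub>F nhds b)"
      by (intro tendsto_intros filterlim_fst filterlim_snd)
    then show "((\<lambda>x. dist (fst x) a + dist (snd x) b) \<longlongrightarrow> 0) (nhds a \<times>\<^sub>F nhds b)" by simp
  qed
  then show "LIM x (nhds a \<times>\<^sub>F nhds b). fst x + snd x :> nhds (a + b)"
    by (subst tendsto_dist_iff)
  show "(uminus \<longlongrightarrow> - a) (nhds a)"
  proof (subst tendsto_dist_iff)
    have "dist (- x) (- a) = dist x a" for x :: 'a
      by (metis absval_minus dist_absval minus_diff_minus)
    moreover have "((\<lambda>x. dist x a) \<longlongrightarrow> dist a a) (nhds a)"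
      by (intro tendsto_intros filterlim_ident)
    ultimately show "((\<lambda>x. dist (- x) (- a)) \<longlongrightarrow> 0) (nhds a)" by simp
  qed
qed

instance ultrametric_field \<subseteq> topological_semigroup_mult
proof
  fix a b :: 'a
  have "((\<lambda>x. dist (fst x * snd x) (a * b)) \<longlongrightarrow> 0) (nhds a \<times>\<^sub>F nhds b)"
  proof (rule tendsto_sandwich[OF _ _ tendsto_const])
    show "\<forall>\<^sub>F x in nhds a \<times>\<^sub>F nhds b. 0 \<le> dist (fst x * snd x) (a * b)" by simp
    have "dist (u * v) (a * b) \<le> dist u a * dist v 0 + absval a * dist v b" for u v :: 'a
      using absval_triangle[of "(u - a) * v" "a * (v - b)"]
      by (simp add: dist_absval flip: absval_mult) (simp add: algebra_simps)
    then show "\<forall>\<^sub>F x in nhds a \<times>\<^sub>F nhds b. dist (fst x * snd x) (a * b)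
        \<le> dist (fst x) a * dist (snd x) 0 + absval a * dist (snd x) b" by auto
    have "((\<lambda>x. dist (fst x) a * dist (snd x) 0 + absval a * dist (snd x) b)
        \<longlongrightarrow> dist a a * dist b 0 + absval a * dist b b) (nhds a \<times>\<^sub>F nhds b)"
      by (intro tendsto_intros filterlim_fst filterlim_snd)
    then show "((\<lambda>x. dist (fst x) a * dist (snd x) 0 + absval a * dist (snd x) b) \<longlongrightarrow> 0) (nhds a \<times>\<^sub>F nhds b)" by simp
  qed
  then show "LIM x (nhds a \<times>\<^sub>F nhds b). fst x * snd x :> nhds (a * b)"
    by (subst tendsto_dist_iff)
qed

lemma continuous_on_mult_ultrametric:
  fixes f g :: "'b::topological_space \<Rightarrow> 'a::ultrametric_field"
  shows "continuous_on S f \<Longrightarrow> continuous_on S g \<Longrightarrow> continuous_on S (\<lambda>x. f x * g x)"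
  unfolding continuous_on_def by (blast intro: tendsto_mult)

text \<open>By the ultrametric inequality a long difference is no larger than the largest of its steps,
  so the Cauchy property only has to be checked for consecutive terms. The averages of a
  \<open>C^(1)\<close>-function and the quotients of geometric sums below converge for this reason.\<close>

lemma convergent_if_differences_vanish:
  fixes X :: "nat \<Rightarrow> 'a::{ultrametric_field, complete_space}"
  assumes bound: "\<And>n. absval (X (Suc n) - X n) \<le> e n" and e: "e \<longlonglongrightarrow> 0"
  shows "convergent X"
proof -
  have "Cauchy X"
  proof (rule metric_CauchyI)
    fix d :: real assume "0 < d"
    then obtain M where M: "\<And>n. n \<ge> M \<Longrightarrow> e n < d"
      using order_tendstoD(2)[OF e] by (auto simp: eventually_sequentially)
    have step: "absval (X (M + j) - X M) < d" for j
    proof (induction j)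
      case (Suc j)
      have "absval (X (Suc (M + j)) - X (M + j)) < d"
        using bound[of "M + j"] M[of "M + j"] by simp
      then show ?case
        using Suc absval_add_le_max[of "X (Suc (M + j)) - X (M + j)" "X (M + j) - X M"] by simp
    qed (use \<open>0 < d\<close> in simp)
    show "\<exists>M. \<forall>m\<ge>M. \<forall>n\<ge>M. dist (X m) (X n) < d"
    proof (intro exI allI impI)
      fix m n assume "M \<le> m" "M \<le> n"
      then have "absval (X m - X M) < d" "absval (X M - X n) < d"
        using step[of "m - M"] step[of "n - M"] absval_minus_commute[of "X n" "X M"] by auto
      then show "dist (X m) (X n) < d"
        using absval_add_le_max[of "X m - X M" "X M - X n"] by (simp add: dist_absval)
    qed
  qed
  then show ?thesis by (rule Cauchy_convergent)
qed

lemma absval_limit_le: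
  fixes X :: "nat \<Rightarrow> 'a::ultrametric_field"
  assumes "X \<longlonglongrightarrow> l" "\<forall>\<^sub>F n in sequentially. absval (X n) \<le> B"
  shows "absval l \<le> B"
proof (rule tendsto_upperbound)
  show "(\<lambda>n. absval (X n)) \<longlonglongrightarrow> absval l"
    using tendsto_dist[OF assms(1) tendsto_const, of 0] by (simp add: dist_absval)
qed (use assms in auto)

text \<open>For the same reason the distance to the limit is bounded by the first remaining step, with no
  summation over the tail.\<close>

lemma LIMSEQ_le_absval_diff:
  fixes X :: "nat \<Rightarrow> 'a::ultrametric_field"
  assumes bound: "\<And>n. absval (X (Suc n) - X n) \<le> e n" and e: "decseq e" "\<And>n. 0 \<le> e n"
    and lim: "X \<longlonglongrightarrow> l"
  shows "absval (l - X n) \<le> e n"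
proof -
  have "absval (X (n + j) - X n) \<le> e n" for j
  proof (induction j)
    case (Suc j)
    have "absval (X (Suc (n + j)) - X (n + j)) \<le> e n"
      using bound[of "n + j"] decseqD[OF e(1), of n "n + j"] by simp
    then show ?case using Suc absval_diff_trans by simp blast
  qed (use e in simp)
  then have "\<forall>\<^sub>F m in sequentially. absval (X m - X n) \<le> e n"
    unfolding eventually_sequentially by (metis le_add_diff_inverse)
  moreover have "(\<lambda>m. X m - X n) \<longlonglongrightarrow> l - X n" by (intro tendsto_intros lim)
  ultimately show ?thesis using absval_limit_le by blast
qed

lemma ultrametric_summable:
  fixes f :: "nat \<Rightarrow> 'a::{ultrametric_field, complete_space}"
  assumes "\<And>n. absval (f n) \<le> M n" "M \<longlonglongrightarrow> 0"
  shows "summable f"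
  unfolding summable_iff_convergent
  by (rule convergent_if_differences_vanish[OF _ assms(2)]) (simp add: assms(1))

text \<open>A Weierstrass test in which \<open>M \<longlonglongrightarrow> 0\<close> replaces summability of \<open>M\<close>: a block of terms is
  bounded by its largest member.\<close>

lemma ultrametric_suminf_continuous:
  fixes f :: "nat \<Rightarrow> 'b::topological_space \<Rightarrow> 'a::{ultrametric_field, complete_space}"
  assumes cont: "\<And>n. continuous_on S (f n)"
    and bound: "\<And>n x. x \<in> S \<Longrightarrow> absval (f n x) \<le> M n" and M: "M \<longlonglongrightarrow> 0"
  shows "continuous_on S (\<lambda>x. \<Sum>n. f n x)"
proof (rule uniform_limit_theorem)
  show "\<forall>\<^sub>F N in sequentially. continuous_on S (\<lambda>x. \<Sum>n<N. f n x)"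
    by (intro always_eventually allI continuous_on_sum cont)
  show "uniform_limit S (\<lambda>N x. \<Sum>n<N. f n x) (\<lambda>x. \<Sum>n. f n x) sequentially"
  proof (rule uniform_limitI)
    fix e :: real assume "0 < e"
    then have "0 < e / 2" by simp
    then obtain N0 where N0: "\<And>n. n \<ge> N0 \<Longrightarrow> M n < e / 2"
      using order_tendstoD(2)[OF M, of "e / 2"] unfolding eventually_sequentially by blast
    have "dist (\<Sum>n<N. f n x) (\<Sum>n. f n x) < e" if "N \<ge> N0" "x \<in> S" for N x
    proof -
      have "summable (\<lambda>n. f n x)" by (rule ultrametric_summable[OF bound[OF that(2)] M])
      then have "(\<lambda>m. \<Sum>n<m. f n x) \<longlonglongrightarrow> (\<Sum>n. f n x)" by (rule summable_LIMSEQ)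
      then have "(\<lambda>m. (\<Sum>n<m. f n x) - (\<Sum>n<N. f n x)) \<longlonglongrightarrow> (\<Sum>n. f n x) - (\<Sum>n<N. f n x)"
        by (intro tendsto_intros)
      moreover have "\<forall>\<^sub>F m in sequentially. absval ((\<Sum>n<m. f n x) - (\<Sum>n<N. f n x)) \<le> e / 2"
        unfolding eventually_sequentially
      proof (intro exI allI impI)
        fix m assume "N \<le> m"
        then have "(\<Sum>n<m. f n x) - (\<Sum>n<N. f n x) = (\<Sum>n\<in>{N..<m}. f n x)"
          by (simp add: sum_diff_nat_ivl lessThan_atLeast0)
        also have "absval \<dots> \<le> e / 2"
        proof (rule absval_sum_le)
          fix i assume "i \<in> {N..<m}"
          then show "absval (f i x) \<le> e / 2"
            using bound[OF that(2), of i] N0[of i] that(1) by simp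
        qed (use \<open>0 < e\<close> in simp)
        finally show "absval ((\<Sum>n<m. f n x) - (\<Sum>n<N. f n x)) \<le> e / 2" .
      qed
      ultimately have "absval ((\<Sum>n. f n x) - (\<Sum>n<N. f n x)) \<le> e / 2" by (rule absval_limit_le)
      then show ?thesis using \<open>0 < e\<close> by (simp add: dist_absval absval_minus_commute)
    qed
    then show "\<forall>\<^sub>F N in sequentially. \<forall>x\<in>S. dist (\<Sum>n<N. f n x) (\<Sum>n. f n x) < e"
      unfolding eventually_sequentially by blast
  qed
qed simp

section \<open>The absolute value of a natural number\<close>

text \<open>In a complete field this normalisation makes the closure of the rationals a copy of the \<open>p\<close>-adic numbers.\<close>

definition is_padic_field :: "nat \<Rightarrow> 'k::ultrametric_field itself \<Rightarrow> bool" where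
  "is_padic_field p K \<longleftrightarrow> prime p \<and> absval (of_nat p :: 'k) = 1 / real p"

text \<open>The parameter \<open>K\<close> fixes the type of the field.\<close>

locale padic =
  fixes p :: nat and K :: "'k::{ultrametric_field, complete_space} itself"
  assumes padic_field: "is_padic_field p K"
begin

text \<open>The absolute value of \<open>p^n\<close>, which is the radius of the cosets modulo \<open>p^n\<close>.\<close>

definition rad :: "nat \<Rightarrow> real" where "rad n = (1 / real p) ^ n"

lemma prime_p: "prime p" and absval_p: "absval (of_nat p :: 'k) = 1 / real p"
  using padic_field by (auto simp: is_padic_field_def)

lemma p_gt_1: "1 < p" and p_pos [simp]: "0 < p" and p_power_pos [simp]: "0 < p ^ n"
  using prime_gt_1_nat[OF prime_p] by auto

lemma inv_p_bounds: "0 < 1 / real p" "1 / real p < 1"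
  using p_gt_1 by auto

lemma rad_pos [simp]: "0 < rad n" and rad_nonneg [simp]: "0 \<le> rad n" and rad_le_1 [simp]: "rad n \<le> 1"
  using inv_p_bounds p_pos by (auto simp: rad_def intro!: power_le_one)

lemma rad_0 [simp]: "rad 0 = 1" and rad_add: "rad (m + n) = rad m * rad n"
  and rad_Suc: "rad (Suc n) = 1 / real p * rad n"
  by (simp_all add: rad_def power_add)

lemma rad_tendsto_0: "rad \<longlonglongrightarrow> 0"
  unfolding rad_def using inv_p_bounds by (intro LIMSEQ_realpow_zero) auto

lemma rad_mono: "m \<le> n \<Longrightarrow> rad n \<le> rad m"
  unfolding rad_def using inv_p_bounds by (intro power_decreasing) auto

lemma rad_le_iff: "rad m \<le> rad n \<longleftrightarrow> n \<le> m"
  unfolding rad_def using inv_p_bounds by (intro power_decreasing_iff) auto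

lemma rad_small:
  assumes "0 < e"
  shows "\<exists>n>0. rad n < e"
proof -
  obtain n where "rad n < e"
    using real_arch_pow_inv[OF assms inv_p_bounds(2)] unfolding rad_def by blast
  then have "rad (Suc n) < e" using rad_mono[of n "Suc n"] by simp
  then show ?thesis by blast
qed

lemma absval_p_power: "absval (of_nat p ^ n :: 'k) = rad n" "absval (of_nat (p ^ n) :: 'k) = rad n"
  by (simp_all add: absval_power absval_p rad_def)

text \<open>If both \<open>u\<close> and \<open>p\<close> had absolute value below 1, then so would \<open>1 = s u + t p\<close>.\<close>

lemma absval_coprime_int:
  assumes "coprime u (int p)"
  shows "absval (of_int u :: 'k) = 1"
proof (rule ccontr)
  assume "absval (of_int u :: 'k) \<noteq> 1"
  then have u: "absval (of_int u :: 'k) < 1" using absval_of_int_le_1[of u, where 'a = 'k] by linarith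
  obtain s t where "s * u + t * int p = 1"
    using bezout_int[of u "int p"] assms by (auto simp: coprime_iff_gcd_eq_1)
  then have "of_int s * of_int u + of_int t * of_nat p = (1 :: 'k)"
    by (metis of_int_1 of_int_add of_int_mult of_int_of_nat_eq)
  moreover have "absval (of_int s * of_int u :: 'k) < 1"
    by (rule le_less_trans[OF absval_unit_mult_le[OF _ order_refl] u]) simp
  moreover have "absval (of_int t * of_nat p :: 'k) < 1"
    by (rule le_less_trans[OF absval_unit_mult_le[OF _ order_refl]]) (use inv_p_bounds in \<open>simp_all add: absval_p\<close>)
  ultimately show False
    using absval_add_le_max[of "of_int s * of_int u :: 'k" "of_int t * of_nat p"] by simp
qed

lemma absval_of_nat:
  assumes "\<not> p dvd u"
  shows "absval (of_nat (p ^ v * u) :: 'k) = rad v"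
proof -
  have "coprime (int u) (int p)"
    using assms prime_p by (metis coprime_commute coprime_int_iff prime_imp_coprime)
  then have "absval (of_int (int u) :: 'k) = 1" by (rule absval_coprime_int)
  then show ?thesis by (simp add: absval_mult absval_p_power)
qed

lemma p_power_times_unit:
  assumes "0 < a"
  obtains v u where "a = p ^ v * u" "\<not> p dvd u"
proof (rule multiplicity_decompose'[of a p])
  show "\<not> is_unit p" using p_gt_1 by simp
qed (use assms that in auto)

lemma absval_of_nat_le_iff: "absval (of_nat a :: 'k) \<le> rad n \<longleftrightarrow> p ^ n dvd a"
proof
  assume "p ^ n dvd a"
  then show "absval (of_nat a :: 'k) \<le> rad n"
    using absval_of_nat_le_1[where 'a = 'k] inv_p_bounds
    by (auto simp: absval_mult absval_p_power intro!: mult_left_le)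
next
  assume le: "absval (of_nat a :: 'k) \<le> rad n"
  show "p ^ n dvd a"
  proof (cases "a = 0")
    case False
    then obtain v u where vu: "a = p ^ v * u" "\<not> p dvd u" using p_power_times_unit[of a] by blast
    then have "rad v \<le> rad n" using le absval_of_nat[of u v] by simp
    then show ?thesis unfolding vu rad_le_iff by (simp add: le_imp_power_dvd dvd_mult2)
  qed simp
qed

lemma absval_of_nat_ge: "0 < a \<Longrightarrow> 1 / real a \<le> absval (of_nat a :: 'k)"
proof -
  assume "0 < a"
  then obtain v u where vu: "a = p ^ v * u" "\<not> p dvd u" using p_power_times_unit[of a] by blast
  then have "p ^ v \<le> a" using \<open>0 < a\<close> by simp
  then have "real p ^ v \<le> real a" by (metis of_nat_le_iff of_nat_power)
  then show ?thesis unfolding vu(1) absval_of_nat[OF vu(2)] using vu(1) p_pos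
    by (simp add: rad_def power_one_over divide_simps)
qed

text \<open>This translates closeness of natural numbers in the field into congruences, the form in which
  computations with cosets are carried out.\<close>

lemma absval_of_nat_diff_le_iff:
  "absval (of_nat a - of_nat b :: 'k) \<le> rad n \<longleftrightarrow> a mod p ^ n = b mod p ^ n"
proof (induction a b rule: linorder_wlog)
  case (le a b)
  have "absval (of_nat a - of_nat b :: 'k) = absval (of_nat (b - a) :: 'k)"
    using le by (simp add: of_nat_diff absval_minus_commute)
  then show ?case using le by (simp only: absval_of_nat_le_iff) (metis mod_eq_dvd_iff_nat)
next
  case (sym a b)
  then show ?case by (metis absval_minus_commute)
qed

section \<open>The \<open>p\<close>-adic integers as the closure of the natural numbers\<close>

text \<open>A rational number \<open>u/v\<close> in lowest terms with \<open>|u/v| \<le> 1\<close> has denominator prime to \<open>p\<close>, so \<open>v\<close>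
  has an inverse \<open>s\<close> modulo \<open>p^n\<close>, and \<open>u s\<close> reduced modulo \<open>p^n\<close> approximates \<open>u/v\<close>.\<close>

lemma rational_approx_nat:
  fixes r :: 'k
  assumes "r \<in> \<rat>" "absval r \<le> 1"
  shows "\<exists>a. absval (r - of_nat a) \<le> rad n"
proof -
  obtain u v where r: "r = of_int u / of_int v" and v: "0 < v" and uv: "coprime u v"
    using Rats_cases'[OF assms(1)] by metis
  have cv: "coprime v (int p)"
  proof (rule ccontr)
    assume "\<not> coprime v (int p)"
    then have dvd: "int p dvd v"
      using prime_p by (metis coprime_commute prime_imp_coprime prime_nat_int_transfer)
    then have "coprime u (int p)" using uv by (meson coprime_divisors dvd_refl)
    then have 1: "absval (of_int u :: 'k) = 1" by (rule absval_coprime_int)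
    obtain w where w: "v = int p * w" using dvd by blast
    have "absval (of_int v :: 'k) = (1 / real p) * absval (of_int w :: 'k)"
      unfolding w by (simp add: absval_mult absval_p)
    also have "\<dots> \<le> 1 / real p * 1"
      using inv_p_bounds by (intro mult_left_mono) auto
    finally have "absval (of_int v :: 'k) < 1" using inv_p_bounds by linarith
    moreover have "0 < absval (of_int v :: 'k)" using v by simp
    ultimately show False using assms(2) 1 by (simp add: r absval_divide)
  qed
  then obtain s t where st: "s * v + t * int p ^ n = 1"
    using bezout_int[of v "int p ^ n"] by (auto simp: coprime_iff_gcd_eq_1[symmetric])
  define b where "b = (u * s) mod int (p ^ n)"
  have "(of_int s * of_int v + of_int t * of_nat p ^ n :: 'k) = 1"
    using arg_cong[OF st, of "of_int :: int \<Rightarrow> 'k"] by simp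
  then have "of_int u * (of_int s * of_int v + of_int t * of_nat p ^ n) = (of_int u :: 'k)" by simp
  then have "of_int u - of_int (u * s) * of_int v = of_int u * of_int t * (of_nat p ^ n :: 'k)"
    unfolding diff_eq_eq by (simp add: distrib_left mult.assoc add.commute)
  moreover have "r - of_int (u * s) = (of_int u - of_int (u * s) * of_int v) / of_int v"
    using v by (simp add: r diff_divide_distrib)
  ultimately have "r - of_int (u * s) = of_int u * of_int t / of_int v * of_nat p ^ n" by simp
  then have "absval (r - of_int (u * s)) = absval (of_int u * of_int t :: 'k) * rad n"
    using absval_coprime_int[OF cv] by (simp add: absval_mult absval_divide absval_p_power)
  also have "\<dots> \<le> 1 * rad n"
    using absval_of_int_le_1[of "u * t", where 'a = 'k] by (intro mult_right_mono) auto
  finally have 1: "absval (r - of_int (u * s)) \<le> rad n" by simp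
  obtain w where w: "u * s - b = int (p ^ n) * w"
    unfolding b_def by (metis minus_mod_eq_mult_div)
  have "absval (of_int (u * s) - of_int b :: 'k) = rad n * absval (of_int w :: 'k)"
    using arg_cong[OF w, of "of_int :: int \<Rightarrow> 'k"] by (simp add: absval_mult absval_p_power)
  also have "\<dots> \<le> rad n * 1" by (intro mult_left_mono) auto
  finally have 2: "absval (of_int (u * s) - of_int b :: 'k) \<le> rad n" by simp
  have "0 \<le> b" by (simp add: b_def)
  then have "of_int b = (of_nat (nat b) :: 'k)" by simp
  then show ?thesis using absval_diff_trans[OF 1 2] by metis
qed

text \<open>Describing \<open>Zp\<close> by approximation with natural numbers turns its closure under the ring
  operations into arithmetic of natural numbers.\<close>

lemma Zp_iff: "(x::'k) \<in> Zp \<longleftrightarrow> (\<forall>n. \<exists>a. absval (x - of_nat a) \<le> rad n)"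
proof
  assume x: "x \<in> Zp"
  show "\<forall>n. \<exists>a. absval (x - of_nat a) \<le> rad n"
  proof
    fix n
    have "x \<in> closure \<rat>" using x by (simp add: Zp_def Qp_def)
    then obtain r where r: "r \<in> \<rat>" "dist r x < rad n"
      unfolding closure_approachable using rad_pos by blast
    have le: "absval (x - r) \<le> rad n" using r(2) by (simp add: dist_absval absval_minus_commute)
    have "absval (x - (x - r)) \<le> 1"
      by (rule absval_diff_le) (use x order_trans[OF le rad_le_1] in \<open>auto simp: Zp_def\<close>)
    then have "absval r \<le> 1" by simp
    then obtain a where "absval (r - of_nat a) \<le> rad n" using rational_approx_nat r by blast
    then show "\<exists>a. absval (x - of_nat a) \<le> rad n" using absval_diff_trans[OF le] by blast
  qed
next
  assume *: "\<forall>n. \<exists>a. absval (x - of_nat a) \<le> rad n"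
  have "x \<in> closure \<rat>"
    unfolding closure_approachable
  proof (intro allI impI)
    fix e :: real assume "0 < e"
    then obtain n where "rad n < e" using rad_small by blast
    then show "\<exists>y\<in>\<rat>. dist y x < e"
      using * by (metis Rats_of_nat dist_absval absval_minus_commute le_less_trans)
  qed
  moreover obtain a where "absval (x - of_nat a) \<le> 1"
    using * rad_le_1 order_trans by meson
  then have "absval x \<le> 1"
    using absval_add_le[of "x - of_nat a" 1 "of_nat a"] by simp
  ultimately show "x \<in> Zp" by (simp add: Zp_def Qp_def)
qed

lemma Zp_of_nat [simp]: "(of_nat a :: 'k) \<in> Zp"
  unfolding Zp_iff by (metis absval_zero diff_self rad_nonneg)

lemma Zp_0 [simp]: "(0 :: 'k) \<in> Zp" and Zp_1 [simp]: "(1 :: 'k) \<in> Zp"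
  using Zp_of_nat[of 0] Zp_of_nat[of 1] by simp_all

lemma Zp_add [simp]:
  assumes "(x::'k) \<in> Zp" "y \<in> Zp"
  shows "x + y \<in> Zp"
  unfolding Zp_iff
proof
  fix n
  obtain a b where "absval (x - of_nat a) \<le> rad n" "absval (y - of_nat b) \<le> rad n"
    using assms unfolding Zp_iff by blast
  then have "absval (x + y - of_nat (a + b)) \<le> rad n"
    using absval_add_le[of "x - of_nat a" "rad n" "y - of_nat b"] by (simp add: algebra_simps)
  then show "\<exists>c. absval (x + y - of_nat c) \<le> rad n" by blast
qed

lemma Zp_uminus [simp]:
  assumes "(x::'k) \<in> Zp"
  shows "- x \<in> Zp"
  unfolding Zp_iff
proof
  fix n
  obtain a where a: "absval (x - of_nat a) \<le> rad n" using assms unfolding Zp_iff by blast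
  \<comment> \<open>\<open>a (p^n - 1)\<close> is a natural number congruent to \<open>-a\<close>\<close>
  have "absval (of_nat (a * p ^ n) :: 'k) \<le> rad n" by (simp only: absval_of_nat_le_iff) simp
  then have "absval ((x - of_nat a) + of_nat (a * p ^ n)) \<le> rad n"
    using a by (rule absval_add_le[rotated])
  moreover have "(x - of_nat a) + of_nat (a * p ^ n) = - (- x - of_nat (a * (p ^ n - 1)))"
    using p_power_pos[of n] by (simp add: of_nat_diff algebra_simps Suc_le_eq)
  ultimately show "\<exists>c. absval (- x - of_nat c) \<le> rad n" by (metis absval_minus)
qed

lemma Zp_diff [simp]: "(x::'k) \<in> Zp \<Longrightarrow> y \<in> Zp \<Longrightarrow> x - y \<in> Zp"
  using Zp_add[of x "- y"] by simp

lemma Zp_of_int [simp]: "(of_int a :: 'k) \<in> Zp"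
  by (cases a rule: int_cases2) auto

lemma Zp_mult [simp]:
  assumes "(x::'k) \<in> Zp" "y \<in> Zp"
  shows "x * y \<in> Zp"
  unfolding Zp_iff
proof
  fix n
  obtain a b where ab: "absval (x - of_nat a) \<le> rad n" "absval (y - of_nat b) \<le> rad n"
    using assms unfolding Zp_iff by blast
  have y: "absval y \<le> 1" using assms by (simp add: Zp_def)
  have "absval ((x - of_nat a) * y + of_nat a * (y - of_nat b)) \<le> rad n"
  proof (rule absval_add_le)
    show "absval ((x - of_nat a) * y) \<le> rad n"
      using absval_unit_mult_le[OF y ab(1)] by (simp add: mult.commute)
    show "absval (of_nat a * (y - of_nat b)) \<le> rad n"
      by (rule absval_unit_mult_le[OF absval_of_nat_le_1 ab(2)])
  qed
  then have "absval (x * y - of_nat (a * b)) \<le> rad n" by (simp add: algebra_simps)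
  then show "\<exists>c. absval (x * y - of_nat c) \<le> rad n" by blast
qed

text \<open>A natural number close to \<open>y\<close> is itself divisible by \<open>p^n\<close>, so it can be divided as well.\<close>

lemma Zp_divide_p_power:
  assumes y: "(y::'k) \<in> Zp" "absval y \<le> rad n"
  shows "y / of_nat p ^ n \<in> Zp"
  unfolding Zp_iff
proof
  fix m
  obtain a where a: "absval (y - of_nat a) \<le> rad (n + m)" using y(1) unfolding Zp_iff by blast
  then have "absval (y - of_nat a) \<le> rad n" using rad_mono[of n "n + m"] by simp
  then have "absval (of_nat a :: 'k) \<le> rad n" using absval_diff_le[OF y(2)] by fastforce
  then obtain b where b: "a = p ^ n * b" unfolding absval_of_nat_le_iff by blast
  have "y / of_nat p ^ n - of_nat b = (y - of_nat a) / of_nat p ^ n"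
    using p_pos by (simp add: b field_simps)
  then have "absval (y / of_nat p ^ n - of_nat b) = absval (y - of_nat a) / rad n"
    by (simp add: absval_divide absval_p_power)
  also have "\<dots> \<le> rad m"
    using a by (simp add: pos_divide_le_eq rad_add mult.commute)
  finally show "\<exists>b. absval (y / of_nat p ^ n - of_nat b) \<le> rad m" by blast
qed

lemma Zp_residue:
  assumes "(x::'k) \<in> Zp"
  obtains a where "a < p ^ n" "absval (x - of_nat a) \<le> rad n"
proof -
  obtain a where a: "absval (x - of_nat a) \<le> rad n" using assms unfolding Zp_iff by blast
  have "absval (of_nat a - of_nat (a mod p ^ n) :: 'k) \<le> rad n"
    by (simp only: absval_of_nat_diff_le_iff) simp
  then have "absval (x - of_nat (a mod p ^ n)) \<le> rad n" by (rule absval_diff_trans[OF a])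
  then show thesis using that[of "a mod p ^ n"] by simp
qed

lemma Zp_limit_of_nats:
  assumes "(x::'k) \<in> Zp"
  obtains a :: "nat \<Rightarrow> nat" where "(\<lambda>n. of_nat (a n)) \<longlonglongrightarrow> x"
proof -
  have "\<forall>n. \<exists>a. absval (x - of_nat a) \<le> rad n" using assms unfolding Zp_iff .
  then obtain a where a: "\<And>n. absval (x - of_nat (a n)) \<le> rad n" by metis
  have "(\<lambda>n. absval (of_nat (a n) - x)) \<longlonglongrightarrow> 0"
    by (rule tendsto_sandwich[OF _ _ tendsto_const rad_tendsto_0])
      (use a in \<open>simp_all add: absval_minus_commute\<close>)
  then show thesis using that LIMSEQ_absval_iff by blast
qed

lemma continuous_on_Zp_of_nat_limit:
  assumes "continuous_on Zp (f :: 'k \<Rightarrow> 'b::topological_space)" "x \<in> Zp" "(\<lambda>n. of_nat (a n)) \<longlonglongrightarrow> x"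
  shows "(\<lambda>n. f (of_nat (a n))) \<longlonglongrightarrow> f x"
  by (rule continuous_on_tendsto_compose[OF assms(1,3,2)]) simp

text \<open>By density of the natural numbers, an identity between continuous functions on \<open>Zp\<close> only has to be
  checked there. This is how facts about ordinary powers and binomial coefficients are carried over to
  \<open>p\<close>-adic arguments.\<close>

lemma Zp_eqI:
  fixes f g :: "'k \<Rightarrow> 'b::t2_space"
  assumes "continuous_on Zp f" "continuous_on Zp g" "\<And>n. f (of_nat n) = g (of_nat n)" "x \<in> Zp"
  shows "f x = g x"
proof -
  obtain a :: "nat \<Rightarrow> nat" where a: "(\<lambda>n. of_nat (a n)) \<longlonglongrightarrow> x" using Zp_limit_of_nats assms(4) .
  show ?thesis
    using continuous_on_Zp_of_nat_limit[OF assms(1,4) a] continuous_on_Zp_of_nat_limit[OF assms(2,4) a]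
    by (simp add: assms(3) LIMSEQ_unique)
qed

lemma Zp_absval_boundI:
  fixes f :: "'k \<Rightarrow> 'k"
  assumes "continuous_on Zp f" "\<And>n. absval (f (of_nat n)) \<le> B" "x \<in> Zp"
  shows "absval (f x) \<le> B"
proof -
  obtain a :: "nat \<Rightarrow> nat" where a: "(\<lambda>n. of_nat (a n)) \<longlonglongrightarrow> x" using Zp_limit_of_nats assms(3) .
  show ?thesis
    by (rule absval_limit_le[OF continuous_on_Zp_of_nat_limit[OF assms(1,3) a]]) (simp add: assms(2))
qed

lemma coset_Zp_conv:
  assumes "(a::'k) \<in> Zp"
  shows "coset_Zp p a n = {y \<in> Zp. absval (y - a) \<le> rad n}"
proof (intro equalityI subsetI)
  fix y assume "y \<in> coset_Zp p a n"
  then obtain z where z: "z \<in> Zp" "y = a + of_nat p ^ n * z" unfolding coset_Zp_def by blast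
  then have "absval z \<le> 1" by (simp add: Zp_def)
  moreover have "y \<in> Zp" using Zp_of_nat[of "p ^ n"] z assms by (simp del: Zp_of_nat)
  ultimately show "y \<in> {y \<in> Zp. absval (y - a) \<le> rad n}"
    using z by (simp add: absval_mult absval_p_power mult_left_le)
next
  fix y assume "y \<in> {y \<in> Zp. absval (y - a) \<le> rad n}"
  then have "(y - a) / of_nat p ^ n \<in> Zp" using assms by (intro Zp_divide_p_power) auto
  moreover have "y = a + of_nat p ^ n * ((y - a) / of_nat p ^ n)" using p_pos by simp
  ultimately show "y \<in> coset_Zp p a n" unfolding coset_Zp_def by blast
qed

lemma coset_Zp_cong:
  assumes "(a::'k) \<in> Zp" "b \<in> Zp" "absval (a - b) \<le> rad n"
  shows "coset_Zp p a n = coset_Zp p b n"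
  using assms absval_diff_trans[of _ a "rad n" b] absval_diff_trans[of _ b "rad n" a]
  by (auto simp: coset_Zp_conv absval_minus_commute)

lemma of_nat_in_coset_Zp_iff:
  "(of_nat x :: 'k) \<in> coset_Zp p (of_nat a) n \<longleftrightarrow> x mod p ^ n = a mod p ^ n"
  by (simp add: coset_Zp_conv absval_of_nat_diff_le_iff)

section \<open>Compact open subsets of the \<open>p\<close>-adic integers\<close>

text \<open>\<open>Zp\<close> is closed in a complete space and totally bounded: the residues below \<open>p^n\<close> form a finite net.\<close>

lemma compact_Zp: "compact (Zp :: 'k set)"
  unfolding compact_eq_totally_bounded
proof (intro conjI allI impI)
  have "closed (Zp :: 'k set)"
  proof -
    have "Zp = closure \<rat> \<inter> cball 0 (1::real) \<inter> (UNIV :: 'k set)"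
      by (auto simp: Zp_def Qp_def dist_absval)
    then show ?thesis by (metis closed_Int closed_UNIV closed_cball closed_closure)
  qed
  then show "complete (Zp :: 'k set)" by (simp add: complete_eq_closed)
next
  fix e :: real assume "0 < e"
  then obtain n where n: "rad n < e" using rad_small by blast
  have "(Zp :: 'k set) \<subseteq> (\<Union>x\<in>of_nat ` {..<p ^ n}. ball x e)"
  proof
    fix x :: 'k assume "x \<in> Zp"
    then obtain a where "a < p ^ n" "absval (x - of_nat a) \<le> rad n" by (rule Zp_residue)
    then show "x \<in> (\<Union>x\<in>of_nat ` {..<p ^ n}. ball x e)"
      using n by (force simp: dist_absval absval_minus_commute)
  qed
  then show "\<exists>k. finite k \<and> (Zp :: 'k set) \<subseteq> (\<Union>x\<in>k. ball x e)" by blast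
qed

text \<open>A coset is a closed ball in \<open>Zp\<close>, and in an ultrametric space closed balls are open.\<close>

lemma coset_Zp_compact_open:
  assumes a: "(a::'k) \<in> Zp"
  shows "coset_Zp p a n \<in> compact_opens_Zp"
proof -
  have eq: "coset_Zp p a n = Zp \<inter> cball a (rad n)"
    by (auto simp: coset_Zp_conv[OF a] dist_absval absval_minus_commute)
  have "open (cball a (rad n))"
    unfolding open_contains_ball
  proof
    fix y assume y: "y \<in> cball a (rad n)"
    have "ball y (rad n) \<subseteq> cball a (rad n)"
    proof
      fix z assume "z \<in> ball y (rad n)"
      then show "z \<in> cball a (rad n)"
        using absval_diff_trans[of a y "rad n" z] y by (simp add: dist_absval)
    qed
    then show "\<exists>e>0. ball y e \<subseteq> cball a (rad n)" using rad_pos by blast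
  qed
  then show ?thesis
    unfolding compact_opens_Zp_def eq using compact_Int_closed[OF compact_Zp closed_cball]
    by (auto intro: openin_open_Int)
qed

lemma compact_opens_Zp_Un:
  "(U :: 'k set) \<in> compact_opens_Zp \<Longrightarrow> V \<in> compact_opens_Zp \<Longrightarrow> U \<union> V \<in> compact_opens_Zp"
  unfolding compact_opens_Zp_def by (auto intro: compact_Un)

lemma compact_opens_Zp_UN:
  assumes "finite A" "\<And>a. a \<in> A \<Longrightarrow> U a \<in> compact_opens_Zp"
  shows "(\<Union>a\<in>A. U a :: 'k set) \<in> compact_opens_Zp"
  using assms by (induction A rule: finite_induct) (auto simp: compact_opens_Zp_Un, simp add: compact_opens_Zp_def)

text \<open>By compactness a single radius works around all points of the set, so that it is a union of cosets of one
  level. The level is taken positive because the values of \<open>\<mu>\<^sub>f\<^sub>,\<^sub>q\<close> are prescribed for positive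
  levels only.\<close>

lemma compact_open_union_of_cosets:
  assumes "(U :: 'k set) \<in> compact_opens_Zp"
  obtains n A where "0 < n" "A \<subseteq> {..<p ^ n}" "U = (\<Union>a\<in>A. coset_Zp p (of_nat a) n)"
proof -
  from assms obtain T where U: "compact U" and T: "open T" "U = Zp \<inter> T"
    unfolding compact_opens_Zp_def openin_open by auto
  have "U \<subseteq> T" using T(2) by simp
  obtain e where e: "0 < e" "(\<Union>x\<in>U. ball x e) \<subseteq> T"
    using compact_subset_open_imp_ball_epsilon_subset[OF U T(1) \<open>U \<subseteq> T\<close>] .
  obtain n where n: "0 < n" "rad n < e" using rad_small[OF e(1)] by auto
  define A where "A = {a. a < p ^ n \<and> of_nat a \<in> U}"
  have sub: "coset_Zp p x n \<subseteq> U" if "x \<in> U" for x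
  proof
    fix y assume "y \<in> coset_Zp p x n"
    moreover have "x \<in> Zp" using that T by simp
    ultimately have "y \<in> Zp" "absval (x - y) \<le> rad n"
      by (auto simp: coset_Zp_conv absval_minus_commute)
    then have "y \<in> ball x e" using n by (simp add: dist_absval)
    then have "y \<in> (\<Union>x\<in>U. ball x e)" using that by blast
    then have "y \<in> T" using e(2) by blast
    then show "y \<in> U" using T(2) \<open>y \<in> Zp\<close> by simp
  qed
  have U_eq: "U = (\<Union>a\<in>A. coset_Zp p (of_nat a) n)"
  proof (intro equalityI subsetI)
    fix x assume x: "x \<in> U"
    then have xZ: "x \<in> Zp" using T by simp
    then obtain a where a: "a < p ^ n" "absval (x - of_nat a) \<le> rad n" by (rule Zp_residue)
    then have "of_nat a \<in> coset_Zp p x n" using xZ by (simp add: coset_Zp_conv absval_minus_commute)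
    then have "a \<in> A" using sub[OF x] a by (auto simp: A_def)
    moreover have "x \<in> coset_Zp p (of_nat a) n" using a xZ by (simp add: coset_Zp_conv)
    ultimately show "x \<in> (\<Union>a\<in>A. coset_Zp p (of_nat a) n)" by blast
  next
    fix x :: 'k assume "x \<in> (\<Union>a\<in>A. coset_Zp p (of_nat a) n)"
    then show "x \<in> U" using sub by (auto simp: A_def)
  qed
  show thesis by (rule that[OF n(1) _ U_eq]) (auto simp: A_def)
qed

section \<open>Continuously differentiable functions on the \<open>p\<close>-adic integers\<close>

text \<open>Writing the difference quotient multiplicatively includes \<open>m = 0\<close>, which removes a case distinction
  from every closure property below.\<close>

lemma C1_ZpI:
  fixes f :: "'k \<Rightarrow> 'k"
  assumes "continuous_on (Zp \<times> Zp) F" "\<And>m x. m \<in> Zp \<Longrightarrow> x \<in> Zp \<Longrightarrow> f (x + m) - f x = m * F (m, x)"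
  shows "f \<in> C1_Zp"
  unfolding C1_Zp_def using assms by (auto intro!: exI[of _ F])

lemma C1_ZpE:
  fixes f :: "'k \<Rightarrow> 'k"
  assumes "f \<in> C1_Zp"
  obtains F where "continuous_on (Zp \<times> Zp) F"
    "\<And>m x. m \<in> Zp \<Longrightarrow> x \<in> Zp \<Longrightarrow> f (x + m) - f x = m * F (m, x)"
proof -
  obtain F where F: "continuous_on (Zp \<times> Zp) F"
      "\<And>m x. m \<in> Zp \<Longrightarrow> x \<in> Zp \<Longrightarrow> m \<noteq> 0 \<Longrightarrow> F (m, x) = (f (x + m) - f x) / m"
    using assms unfolding C1_Zp_def by blast
  show thesis
  proof (rule that[OF F(1)])
    fix m x :: 'k assume "m \<in> Zp" "x \<in> Zp"
    then show "f (x + m) - f x = m * F (m, x)" using F(2)[of m x] by (cases "m = 0") auto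
  qed
qed

lemma C1_Zp_continuous:
  fixes f :: "'k \<Rightarrow> 'k"
  assumes "f \<in> C1_Zp"
  shows "continuous_on Zp f"
proof -
  obtain F where F: "continuous_on (Zp \<times> Zp) F"
      "\<And>m x. m \<in> Zp \<Longrightarrow> x \<in> Zp \<Longrightarrow> f (x + m) - f x = m * F (m, x)"
    by (rule C1_ZpE[OF assms]) blast
  have "continuous_on Zp (\<lambda>x. F (x, 0))"
    by (rule continuous_on_compose2[OF F(1)]) (auto intro!: continuous_intros)
  then have "continuous_on Zp (\<lambda>x. f 0 + x * F (x, 0))"
    by (intro continuous_intros continuous_on_mult_ultrametric)
  then show ?thesis
  proof (rule continuous_on_eq)
    fix x :: 'k assume "x \<in> Zp"
    then show "f 0 + x * F (x, 0) = f x" using F(2)[of x 0] by (simp add: algebra_simps)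
  qed
qed

text \<open>The extended difference quotient is continuous on a compact set, hence bounded.\<close>

lemma C1_Zp_Lipschitz:
  fixes f :: "'k \<Rightarrow> 'k"
  assumes "f \<in> C1_Zp"
  obtains B where "0 < B" "\<And>x y. x \<in> Zp \<Longrightarrow> y \<in> Zp \<Longrightarrow> absval (f x - f y) \<le> B * absval (x - y)"
proof -
  obtain F where F: "continuous_on (Zp \<times> Zp) F"
      "\<And>m x. m \<in> Zp \<Longrightarrow> x \<in> Zp \<Longrightarrow> f (x + m) - f x = m * F (m, x)"
    by (rule C1_ZpE[OF assms]) blast
  have "bounded (F ` (Zp \<times> Zp))"
    by (intro compact_imp_bounded compact_continuous_image F(1) compact_Times compact_Zp)
  then obtain B where B: "\<And>z. z \<in> Zp \<times> Zp \<Longrightarrow> dist 0 (F z) \<le> B"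
    unfolding bounded_any_center[where a = 0] by blast
  have "absval (f x - f y) \<le> max B 1 * absval (x - y)" if "x \<in> Zp" "y \<in> Zp" for x y
  proof -
    have "absval (F (x - y, y)) \<le> max B 1"
      using B[of "(x - y, y)"] that by (simp add: dist_absval)
    then show ?thesis
      using F(2)[of "x - y" y] that
      by (simp add: absval_mult mult.commute[of "absval (x - y)"] mult_right_mono)
  qed
  then show thesis using that[of "max B 1"] by simp
qed

lemma C1_Zp_const: "(\<lambda>x. c :: 'k) \<in> C1_Zp"
  by (rule C1_ZpI[where F = "\<lambda>_. 0"]) auto

lemma C1_Zp_add:
  fixes f g :: "'k \<Rightarrow> 'k"
  assumes "f \<in> C1_Zp" "g \<in> C1_Zp"
  shows "(\<lambda>x. f x + g x) \<in> C1_Zp"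
proof -
  obtain F where F: "continuous_on (Zp \<times> Zp) F"
      "\<And>m x. m \<in> Zp \<Longrightarrow> x \<in> Zp \<Longrightarrow> f (x + m) - f x = m * F (m, x)"
    by (rule C1_ZpE[OF assms(1)]) blast
  obtain G where G: "continuous_on (Zp \<times> Zp) G"
      "\<And>m x. m \<in> Zp \<Longrightarrow> x \<in> Zp \<Longrightarrow> g (x + m) - g x = m * G (m, x)"
    by (rule C1_ZpE[OF assms(2)]) blast
  show ?thesis
    by (rule C1_ZpI[where F = "\<lambda>z. F z + G z"])
      (use F G in \<open>auto intro!: continuous_intros simp: distrib_left simp flip: F(2) G(2)\<close>)
qed

lemma C1_Zp_mult:
  fixes f g :: "'k \<Rightarrow> 'k"
  assumes "f \<in> C1_Zp" "g \<in> C1_Zp"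
  shows "(\<lambda>x. f x * g x) \<in> C1_Zp"
proof -
  obtain F where F: "continuous_on (Zp \<times> Zp) F"
      "\<And>m x. m \<in> Zp \<Longrightarrow> x \<in> Zp \<Longrightarrow> f (x + m) - f x = m * F (m, x)"
    by (rule C1_ZpE[OF assms(1)]) blast
  obtain G where G: "continuous_on (Zp \<times> Zp) G"
      "\<And>m x. m \<in> Zp \<Longrightarrow> x \<in> Zp \<Longrightarrow> g (x + m) - g x = m * G (m, x)"
    by (rule C1_ZpE[OF assms(2)]) blast
  show ?thesis
  proof (rule C1_ZpI[where F = "\<lambda>z. f (snd z + fst z) * G z + g (snd z) * F z"])
    have "continuous_on (Zp \<times> Zp) (\<lambda>z. f (snd z + fst z))"
      by (rule continuous_on_compose2[OF C1_Zp_continuous[OF assms(1)]]) (auto intro!: continuous_intros)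
    moreover have "continuous_on (Zp \<times> Zp) (\<lambda>z. g (snd z :: 'k))"
      by (rule continuous_on_compose2[OF C1_Zp_continuous[OF assms(2)]]) (auto intro!: continuous_intros)
    ultimately show "continuous_on (Zp \<times> Zp) (\<lambda>z. f (snd z + fst z) * G z + g (snd z) * F z)"
      using F(1) G(1) by (intro continuous_on_add continuous_on_mult_ultrametric)
  next
    fix m x :: 'k assume mx: "m \<in> Zp" "x \<in> Zp"
    have "f (x + m) * g (x + m) - f x * g x
        = f (x + m) * (g (x + m) - g x) + g x * (f (x + m) - f x)"
      by (simp add: algebra_simps)
    also have "\<dots> = m * (f (x + m) * G (m, x) + g x * F (m, x))"
      unfolding F(2)[OF mx] G(2)[OF mx] by (simp add: algebra_simps)
    finally show "f (x + m) * g (x + m) - f x * g x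
        = m * (f (snd (m, x) + fst (m, x)) * G (m, x) + g (snd (m, x)) * F (m, x))" by simp
  qed
qed

lemma C1_Zp_reflect:
  fixes f :: "'k \<Rightarrow> 'k"
  assumes "f \<in> C1_Zp"
  shows "(\<lambda>x. f (- x)) \<in> C1_Zp"
proof -
  obtain F where F: "continuous_on (Zp \<times> Zp) F"
      "\<And>m x. m \<in> Zp \<Longrightarrow> x \<in> Zp \<Longrightarrow> f (x + m) - f x = m * F (m, x)"
    by (rule C1_ZpE[OF assms(1)]) blast
  show ?thesis
  proof (rule C1_ZpI[where F = "\<lambda>z. - F (- fst z, - snd z)"])
    show "continuous_on (Zp \<times> Zp) (\<lambda>z. - F (- fst z, - snd z))"
      by (intro continuous_on_minus continuous_on_compose2[OF F(1)]) (auto intro!: continuous_intros)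
    fix m x :: 'k assume "m \<in> Zp" "x \<in> Zp"
    then show "f (- (x + m)) - f (- x) = m * - F (- fst (m, x), - snd (m, x))"
      using F(2)[of "- m" "- x"] by simp
  qed
qed

lemma C1_Zp_power: "f \<in> C1_Zp \<Longrightarrow> (\<lambda>x. f x ^ n :: 'k) \<in> C1_Zp"
  by (induction n) (auto intro: C1_Zp_const C1_Zp_mult)

lemma C1_Zp_poly: "f \<in> C1_Zp \<Longrightarrow> (\<lambda>x. poly R (f x) :: 'k) \<in> C1_Zp"
  by (induction R) (auto intro: C1_Zp_const C1_Zp_mult C1_Zp_add)

section \<open>The Volkenborn integral of a continuously differentiable function\<close>

lemma sum_by_residue:
  fixes f :: "nat \<Rightarrow> 'b::comm_monoid_add"
  shows "(\<Sum>x<A * B. f x) = (\<Sum>a<A. \<Sum>y<B. f (a + A * y))"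
proof -
  have "(\<Sum>x<A * B. f x) = (\<Sum>y<B. sum f {y * A..<y * A + A})"
    by (simp add: sum.nat_group mult.commute)
  also have "\<dots> = (\<Sum>y<B. \<Sum>a<A. f (a + A * y))"
  proof (rule sum.cong[OF refl])
    fix y
    show "sum f {y * A..<y * A + A} = (\<Sum>a<A. f (a + A * y))"
      using sum.shift_bounds_nat_ivl[of f 0 "y * A" A] by (simp add: lessThan_atLeast0 add.commute mult.commute)
  qed
  also have "\<dots> = (\<Sum>a<A. \<Sum>y<B. f (a + A * y))" by (rule sum.swap)
  finally show ?thesis .
qed

lemma sum_p_power_Suc:
  fixes f :: "nat \<Rightarrow> 'b::comm_monoid_add"
  shows "(\<Sum>x<p ^ Suc N. f x) = (\<Sum>a<p ^ N. \<Sum>y<p. f (a + p ^ N * y))"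
  using sum_by_residue[of f "p ^ N" p] by (simp add: mult.commute)

text \<open>The shape of the recursion satisfied by \<open>\<Sum>x<p^N. \<phi>(x)\<close> below: a contraction, up to an error that
  is eventually as small as desired.\<close>

lemma eventually_contracting_tendsto_0:
  fixes a :: "nat \<Rightarrow> real"
  assumes nonneg: "\<And>n. 0 \<le> a n" and r: "0 \<le> r" "r < 1"
    and step: "\<And>e. 0 < e \<Longrightarrow> \<forall>\<^sub>F n in sequentially. a (Suc n) \<le> max (r * a n) e"
  shows "a \<longlonglongrightarrow> 0"
proof (rule LIMSEQ_I)
  fix e :: real assume "0 < e"
  then obtain N where N: "\<And>n. n \<ge> N \<Longrightarrow> a (Suc n) \<le> max (r * a n) (e / 2)"
    using step[of "e / 2"] unfolding eventually_sequentially by auto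
  have bound: "a (N + j) \<le> max (r ^ j * a N) (e / 2)" for j
  proof (induction j)
    case (Suc j)
    have "r * a (N + j) \<le> r * max (r ^ j * a N) (e / 2)" using Suc r by (intro mult_left_mono)
    also have "\<dots> = max (r * (r ^ j * a N)) (r * (e / 2))" using r by (simp add: max_mult_distrib_left)
    also have "\<dots> \<le> max (r ^ Suc j * a N) (e / 2)"
      using r \<open>0 < e\<close> mult_left_le_one_le[of "e / 2" r] by (intro max.mono) auto
    finally show ?case using N[of "N + j"] by auto
  qed simp
  have "(\<lambda>j. r ^ j * a N) \<longlonglongrightarrow> 0" using r by (intro tendsto_mult_left_zero LIMSEQ_realpow_zero)
  from order_tendstoD(2)[OF this \<open>0 < e\<close>]
  obtain J where J: "\<And>j. j \<ge> J \<Longrightarrow> r ^ j * a N < e"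
    unfolding eventually_sequentially by blast
  show "\<exists>M. \<forall>n\<ge>M. norm (a n - 0) < e"
  proof (intro exI allI impI)
    fix n assume "N + J \<le> n"
    then have "a n \<le> max (r ^ (n - N) * a N) (e / 2)" "r ^ (n - N) * a N < e"
      using bound[of "n - N"] J[of "n - N"] by auto
    then show "norm (a n - 0) < e" using nonneg[of n] \<open>0 < e\<close> by auto
  qed
qed

text \<open>Passing from \<open>N\<close> to \<open>N + 1\<close> repeats each value \<open>p\<close> times up to the oscillation of \<open>\<phi>\<close> on balls of
  radius \<open>p^(-N)\<close>. The repetition multiplies the sum by \<open>p\<close>, which contracts; the oscillation tends to 0
  by uniform continuity.\<close>

lemma sum_nats_below_p_power_tendsto_0:
  fixes \<phi> :: "'k \<Rightarrow> 'k"
  assumes \<phi>: "continuous_on Zp \<phi>"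
  shows "(\<lambda>N. \<Sum>x<p ^ N. \<phi> (of_nat x)) \<longlonglongrightarrow> 0"
proof -
  define b where "b N = (\<Sum>x<p ^ N. \<phi> (of_nat x))" for N
  have "(\<lambda>N. absval (b N)) \<longlonglongrightarrow> 0"
  proof (rule eventually_contracting_tendsto_0[of _ "1 / real p"])
    fix e :: real assume e: "0 < e"
    have "uniformly_continuous_on Zp \<phi>" using \<phi> compact_Zp by (rule compact_uniformly_continuous)
    then obtain d where d: "0 < d" "\<And>x y. x \<in> Zp \<Longrightarrow> y \<in> Zp \<Longrightarrow> dist y x < d \<Longrightarrow> dist (\<phi> y) (\<phi> x) < e"
      using e unfolding uniformly_continuous_on_def by metis
    have "\<forall>\<^sub>F N in sequentially. rad N < d" using order_tendstoD(2)[OF rad_tendsto_0 d(1)] .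
    then show "\<forall>\<^sub>F N in sequentially. absval (b (Suc N)) \<le> max (1 / real p * absval (b N)) e"
    proof eventually_elim
      case (elim N)
      have "b (Suc N) = (\<Sum>a<p ^ N. \<Sum>y<p. \<phi> (of_nat (a + p ^ N * y)))"
        unfolding b_def by (rule sum_p_power_Suc)
      also have "\<dots> = (\<Sum>a<p ^ N. \<Sum>y<p. \<phi> (of_nat a))
          + (\<Sum>a<p ^ N. \<Sum>y<p. \<phi> (of_nat (a + p ^ N * y)) - \<phi> (of_nat a))"
        by (simp add: sum_subtractf)
      also have "(\<Sum>a<p ^ N. \<Sum>y<p. \<phi> (of_nat a)) = of_nat p * b N"
        by (simp add: b_def sum_distrib_left)
      finally have "b (Suc N) = of_nat p * b N
          + (\<Sum>a<p ^ N. \<Sum>y<p. \<phi> (of_nat (a + p ^ N * y)) - \<phi> (of_nat a))" .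
      moreover have "absval (\<Sum>a<p ^ N. \<Sum>y<p. \<phi> (of_nat (a + p ^ N * y)) - \<phi> (of_nat a)) \<le> e"
      proof (intro absval_sum_le)
        fix a y
        have "absval (of_nat (a + p ^ N * y) - of_nat a :: 'k) \<le> rad N"
          by (simp only: absval_of_nat_diff_le_iff) simp
        then have "dist (of_nat (a + p ^ N * y) :: 'k) (of_nat a) < d"
          unfolding dist_absval using elim by (rule le_less_trans)
        then show "absval (\<phi> (of_nat (a + p ^ N * y)) - \<phi> (of_nat a)) \<le> e"
          using d(2)[of "of_nat a" "of_nat (a + p ^ N * y)"] Zp_of_nat unfolding dist_absval by (meson less_imp_le)
      qed (use e in auto)
      moreover have "absval (of_nat p * b N) = 1 / real p * absval (b N)"
        by (simp add: absval_mult absval_p)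
      ultimately show ?case
        using absval_add_le_max[of "of_nat p * b N"] by (smt (verit) max.cobounded1 max.cobounded2)
    qed
  qed (use inv_p_bounds in auto)
  then show ?thesis unfolding LIMSEQ_absval_iff[of _ 0] b_def by simp
qed

text \<open>Consecutive averages differ by \<open>(1/p) \<Sum>x<p^N. \<Sum>j<p. j F(p^N j, x)\<close>, where \<open>F\<close> is the extended difference
  quotient: the factor \<open>p^N\<close> of the increment cancels the denominator. Up to a uniformly small error
  \<open>F(p^N j, x)\<close> may be replaced by \<open>F(0, x)\<close>, and the sum of a continuous function over \<open>x < p^N\<close>
  tends to 0.\<close>

lemma Volkenborn_convergent:
  fixes G :: "'k \<Rightarrow> 'k"
  assumes "G \<in> C1_Zp"
  shows "convergent (\<lambda>N. 1 / of_nat (p ^ N) * (\<Sum>x<p ^ N. G (of_nat x)))"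
proof -
  define A where "A N = 1 / of_nat (p ^ N) * (\<Sum>x<p ^ N. G (of_nat x))" for N
  obtain F where F: "continuous_on (Zp \<times> Zp) F"
      "\<And>m x. m \<in> Zp \<Longrightarrow> x \<in> Zp \<Longrightarrow> G (x + m) - G x = m * F (m, x)"
    by (rule C1_ZpE[OF assms(1)]) blast
  define b where "b N = (\<Sum>x<p ^ N. F (0, of_nat x))" for N
  have "continuous_on Zp (\<lambda>x. F (0, x))"
    by (rule continuous_on_compose2[OF F(1)]) (auto intro!: continuous_intros)
  then have b: "b \<longlonglongrightarrow> 0" unfolding b_def by (rule sum_nats_below_p_power_tendsto_0)
  \<comment> \<open>Sort the numbers below \<open>p^(N+1)\<close> by their residues modulo \<open>p^N\<close>, and compare each with its residue.\<close>
  have diff: "A (Suc N) - A N = 1 / of_nat p * (\<Sum>x<p ^ N. \<Sum>j<p. of_nat j * F (of_nat (p ^ N * j), of_nat x))" for N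
  proof -
    have "A N = 1 / of_nat (p ^ Suc N) * (\<Sum>x<p ^ N. \<Sum>j<p. G (of_nat x))"
      using p_gt_1 by (simp add: A_def sum_distrib_left[symmetric] field_simps)
    moreover have "A (Suc N) = 1 / of_nat (p ^ Suc N) * (\<Sum>x<p ^ N. \<Sum>j<p. G (of_nat (x + p ^ N * j)))"
      unfolding A_def sum_p_power_Suc ..
    moreover have "G (of_nat x + of_nat (p ^ N * j)) - G (of_nat x)
        = of_nat (p ^ N) * (of_nat j * F (of_nat (p ^ N * j), of_nat x))" for x j
      using F(2)[OF Zp_of_nat[of "p ^ N * j"] Zp_of_nat[of x]] by (simp only: of_nat_mult mult.assoc)
    ultimately have "A (Suc N) - A N
        = 1 / of_nat (p ^ Suc N)
          * (\<Sum>x<p ^ N. \<Sum>j<p. of_nat (p ^ N) * (of_nat j * F (of_nat (p ^ N * j), of_nat x)))"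
      by (simp only: of_nat_add right_diff_distrib[symmetric] sum_subtractf[symmetric])
    also have "\<dots> = 1 / of_nat p * (\<Sum>x<p ^ N. \<Sum>j<p. of_nat j * F (of_nat (p ^ N * j), of_nat x))"
      using p_gt_1 by (simp add: sum_distrib_left[symmetric])
    finally show ?thesis .
  qed
  have "(\<lambda>N. absval (A (Suc N) - A N)) \<longlonglongrightarrow> 0"
  proof (rule LIMSEQ_I)
    fix e :: real assume "0 < e"
    then have e: "0 < e / (2 * real p)" using p_pos by simp
    have "uniformly_continuous_on (Zp \<times> Zp) F"
      using F(1) by (intro compact_uniformly_continuous compact_Times compact_Zp)
    then obtain d where d: "0 < d"
        "\<And>y z. y \<in> Zp \<times> Zp \<Longrightarrow> z \<in> Zp \<times> Zp \<Longrightarrow> dist z y < d \<Longrightarrow> dist (F z) (F y) < e / (2 * real p)"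
      using e unfolding uniformly_continuous_on_def by metis
    have "\<forall>\<^sub>F N in sequentially. rad N < d" using order_tendstoD(2)[OF rad_tendsto_0 d(1)] .
    moreover have "\<forall>\<^sub>F N in sequentially. absval (b N) < e / (2 * real p)"
      using order_tendstoD(2)[of "\<lambda>N. absval (b N)" 0, OF _ e] b unfolding LIMSEQ_absval_iff[of b] by simp
    ultimately have "\<forall>\<^sub>F N in sequentially. absval (A (Suc N) - A N) < e"
    proof eventually_elim
      case (elim N)
      let ?S = "\<Sum>x<p ^ N. \<Sum>j<p. of_nat j * F (of_nat (p ^ N * j), of_nat x)"
      have "?S = (\<Sum>j<p. of_nat j) * b N
            + (\<Sum>x<p ^ N. \<Sum>j<p. of_nat j * (F (of_nat (p ^ N * j), of_nat x) - F (0, of_nat x)))"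
        unfolding b_def by (simp add: right_diff_distrib sum_subtractf sum_distrib_right sum_distrib_left)
      also have "absval \<dots> \<le> e / (2 * real p)"
      proof (rule absval_add_le)
        have "absval (\<Sum>j<p. of_nat j :: 'k) \<le> 1" by (intro absval_sum_le) auto
        then show "absval ((\<Sum>j<p. of_nat j) * b N) \<le> e / (2 * real p)"
          using elim(2) by (intro absval_unit_mult_le) auto
        show "absval (\<Sum>x<p ^ N. \<Sum>j<p. of_nat j * (F (of_nat (p ^ N * j), of_nat x) - F (0, of_nat x)))
            \<le> e / (2 * real p)"
        proof (intro absval_sum_le absval_unit_mult_le)
          fix x j
          have "absval (of_nat (p ^ N * j) :: 'k) \<le> rad N" by (simp only: absval_of_nat_le_iff) simp
          then have "dist (of_nat (p ^ N * j), of_nat x) (0 :: 'k, of_nat x :: 'k) < d"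
            using elim(1) by (simp add: dist_Pair_Pair dist_absval del: of_nat_mult)
          moreover have "(of_nat (p ^ N * j), of_nat x) \<in> (Zp \<times> Zp :: ('k \<times> 'k) set)"
            "(0, of_nat x) \<in> (Zp \<times> Zp :: ('k \<times> 'k) set)"
            by (simp_all del: of_nat_mult)
          ultimately show "absval (F (of_nat (p ^ N * j), of_nat x) - F (0, of_nat x)) \<le> e / (2 * real p)"
            using d(2) unfolding dist_absval by (meson less_imp_le)
        qed (use e in auto)
      qed
      finally have "absval ?S \<le> e / (2 * real p)" .
      then have "real p * absval ?S \<le> real p * (e / (2 * real p))" by (rule mult_left_mono) simp
      also have "\<dots> < e" using p_gt_1 \<open>0 < e\<close> by simp
      finally show "absval (A (Suc N) - A N) < e"
        unfolding diff absval_mult absval_divide absval_p absval_one by simp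
    qed
    then show "\<exists>M. \<forall>N\<ge>M. norm (absval (A (Suc N) - A N) - 0) < e"
      unfolding eventually_sequentially by auto
  qed
  from convergent_if_differences_vanish[OF order_refl this] show ?thesis unfolding A_def .
qed

section \<open>Distributions are determined by their values on cosets\<close>

lemma coset_Zp_disjoint:
  assumes "a < p ^ n" "b < p ^ n" "a \<noteq> b"
  shows "coset_Zp p (of_nat a :: 'k) n \<inter> coset_Zp p (of_nat b) n = {}"
proof (rule ccontr)
  assume "\<not> ?thesis"
  then obtain y :: 'k where "absval (y - of_nat a) \<le> rad n" "absval (y - of_nat b) \<le> rad n"
    by (auto simp: coset_Zp_conv)
  then have "absval (of_nat a - of_nat b :: 'k) \<le> rad n"
    using absval_diff_trans[of "of_nat a" y "rad n" "of_nat b"] by (simp add: absval_minus_commute)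
  then show False using assms by (simp only: absval_of_nat_diff_le_iff) simp
qed

lemma distribution_union_of_cosets:
  fixes \<mu> :: "'k set \<Rightarrow> 'k"
  assumes \<mu>: "distribution_Zp \<mu>" and A: "A \<subseteq> {..<p ^ n}"
  shows "\<mu> (\<Union>a\<in>A. coset_Zp p (of_nat a) n) = (\<Sum>a\<in>A. \<mu> (coset_Zp p (of_nat a) n))"
proof -
  have add: "\<mu> (U \<union> V) = \<mu> U + \<mu> V"
    if "U \<in> compact_opens_Zp" "V \<in> compact_opens_Zp" "U \<inter> V = {}" for U V
    using \<mu> that unfolding distribution_Zp_def by blast
  have empty: "{} \<in> (compact_opens_Zp :: 'k set set)" by (simp add: compact_opens_Zp_def)
  have "finite A" using A finite_subset by blast
  then show ?thesis using A
  proof (induction A rule: finite_induct)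
    case empty
    then show ?case using add[of "{}" "{}"] \<open>{} \<in> compact_opens_Zp\<close> by simp
  next
    case (insert a A)
    have "\<mu> (coset_Zp p (of_nat a) n \<union> (\<Union>a\<in>A. coset_Zp p (of_nat a) n))
        = \<mu> (coset_Zp p (of_nat a) n) + \<mu> (\<Union>a\<in>A. coset_Zp p (of_nat a) n)"
    proof (rule add)
      show "coset_Zp p (of_nat a :: 'k) n \<inter> (\<Union>a\<in>A. coset_Zp p (of_nat a) n) = {}"
      proof -
        have "coset_Zp p (of_nat a :: 'k) n \<inter> coset_Zp p (of_nat b) n = {}" if "b \<in> A" for b
          using insert.prems insert.hyps that by (intro coset_Zp_disjoint) auto
        then show ?thesis by blast
      qed
    qed (use insert.hyps in \<open>auto intro!: compact_opens_Zp_UN coset_Zp_compact_open\<close>)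
    then show ?case using insert by simp
  qed
qed

lemma nats_below_in_coset:
  assumes "a < p ^ n" "n \<le> m"
  shows "{x. x < p ^ m \<and> (of_nat x :: 'k) \<in> coset_Zp p (of_nat a) n} = (\<lambda>y. a + p ^ n * y) ` {..<p ^ (m - n)}"
proof (intro equalityI subsetI)
  fix x assume "x \<in> {x. x < p ^ m \<and> (of_nat x :: 'k) \<in> coset_Zp p (of_nat a) n}"
  then have "x < p ^ (m - n) * p ^ n" "x mod p ^ n = a"
    using assms by (auto simp: of_nat_in_coset_Zp_iff simp flip: power_add)
  then have "x div p ^ n < p ^ (m - n)" "x = a + p ^ n * (x div p ^ n)"
    using less_mult_imp_div_less by (auto simp: mod_mult_div_eq)
  then show "x \<in> (\<lambda>y. a + p ^ n * y) ` {..<p ^ (m - n)}" by blast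
next
  fix x assume "x \<in> (\<lambda>y. a + p ^ n * y) ` {..<p ^ (m - n)}"
  then obtain y where y: "y < p ^ (m - n)" "x = a + p ^ n * y" by blast
  have "x < p ^ n * Suc y" using assms y by simp
  also have "\<dots> \<le> p ^ n * p ^ (m - n)" using y by (intro mult_left_mono) auto
  also have "\<dots> = p ^ m" using assms by (simp flip: power_add)
  finally show "x \<in> {x. x < p ^ m \<and> (of_nat x :: 'k) \<in> coset_Zp p (of_nat a) n}"
    using assms y by (simp only: mem_Collect_eq of_nat_in_coset_Zp_iff) simp
qed

text \<open>Any function for which the prescribed limits exist has exactly one associated distribution. The
  distribution is constructed as the limit of the finitely additive set functions
  \<open>S m U = (1/[p^m]_q) \<Sum>x<p^m, x \<in> U. f(x)\<close>, so that additivity holds before the limit is taken and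
  no refinement of partitions has to be compared. On a coset, \<open>S m\<close> is the prescribed sum.\<close>

lemma is_mu_fq_ex1:
  fixes q :: 'k and f :: "'k \<Rightarrow> 'k"
  assumes conv: "\<And>n a. 0 < n \<Longrightarrow> a < p ^ n \<Longrightarrow>
    convergent (\<lambda>m. 1 / qnum q (of_nat (p ^ m)) * (\<Sum>x<p ^ (m - n). f (of_nat (a + p ^ n * x))))"
  shows "\<exists>!\<mu>. is_mu_fq p q f \<mu>"
proof (rule ex_ex1I)
  define S where "S m U = 1 / qnum q (of_nat (p ^ m)) * (\<Sum>x | x < p ^ m \<and> of_nat x \<in> U. f (of_nat x))" for m and U :: "'k set"
  have S_Un: "S m (U \<union> V) = S m U + S m V" if "U \<inter> V = {}" for m U V
  proof -
    have eq: "{x. x < p ^ m \<and> of_nat x \<in> U \<union> V} = {x. x < p ^ m \<and> of_nat x \<in> U} \<union> {x. x < p ^ m \<and> of_nat x \<in> V}"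
      by auto
    have "(\<Sum>x | x < p ^ m \<and> of_nat x \<in> U \<union> V. f (of_nat x))
        = (\<Sum>x | x < p ^ m \<and> of_nat x \<in> U. f (of_nat x)) + (\<Sum>x | x < p ^ m \<and> of_nat x \<in> V. f (of_nat x))"
      unfolding eq using that by (intro sum.union_disjoint) auto
    then show ?thesis unfolding S_def by (simp add: distrib_left)
  qed
  have S_distr: "distribution_Zp (restrict (S m) compact_opens_Zp)" for m
    unfolding distribution_Zp_def by (auto simp: compact_opens_Zp_Un S_Un)
  have S_coset: "\<forall>\<^sub>F m in sequentially. S m (coset_Zp p (of_nat a) n)
      = 1 / qnum q (of_nat (p ^ m)) * (\<Sum>x<p ^ (m - n). f (of_nat (a + p ^ n * x)))"
    if "a < p ^ n" for a n
    using eventually_ge_at_top[of n]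
  proof eventually_elim
    case (elim m)
    show ?case
      unfolding S_def nats_below_in_coset[OF that elim] using p_gt_1 by (subst sum.reindex) (auto simp: inj_on_def)
  qed
  have S_coset_conv: "convergent (\<lambda>m. S m (coset_Zp p (of_nat a) n))" if "0 < n" "a < p ^ n" for a n
    using conv[OF that] convergent_cong[OF S_coset[OF that(2)]] by simp
  have S_conv: "convergent (\<lambda>m. S m U)" if "U \<in> compact_opens_Zp" for U
  proof -
    from that obtain n A where nA: "0 < n" "A \<subseteq> {..<p ^ n}"
      and U: "U = (\<Union>a\<in>A. coset_Zp p (of_nat a) n)"
      by (rule compact_open_union_of_cosets)
    have "S m U = (\<Sum>a\<in>A. S m (coset_Zp p (of_nat a) n))" for m
      using distribution_union_of_cosets[OF S_distr nA(2), of m] that unfolding U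
      by (simp add: coset_Zp_compact_open)
    moreover have "convergent (\<lambda>m. \<Sum>a\<in>A. S m (coset_Zp p (of_nat a) n))"
    proof -
      have "(\<lambda>m. \<Sum>a\<in>A. S m (coset_Zp p (of_nat a) n)) \<longlonglongrightarrow> (\<Sum>a\<in>A. lim (\<lambda>m. S m (coset_Zp p (of_nat a) n)))"
        using S_coset_conv[OF nA(1)] nA(2) by (intro tendsto_sum) (auto simp: convergent_LIMSEQ_iff)
      then show ?thesis by (rule convergentI)
    qed
    ultimately show ?thesis by simp
  qed
  define \<mu> where "\<mu> = restrict (\<lambda>U. lim (\<lambda>m. S m U)) compact_opens_Zp"
  have lim: "(\<lambda>m. S m U) \<longlonglongrightarrow> \<mu> U" if "U \<in> compact_opens_Zp" for U
    using S_conv[OF that] that by (simp add: \<mu>_def convergent_LIMSEQ_iff)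
  have "is_mu_fq p q f \<mu>"
    unfolding is_mu_fq_def distribution_Zp_def
  proof (intro conjI ballI impI allI)
    show "\<mu> \<in> extensional compact_opens_Zp" by (simp add: \<mu>_def)
    fix U V :: "'k set" assume UV: "U \<in> compact_opens_Zp" "V \<in> compact_opens_Zp" "U \<inter> V = {}"
    have "(\<lambda>m. S m (U \<union> V)) \<longlonglongrightarrow> \<mu> U + \<mu> V"
      unfolding S_Un[OF UV(3)] by (intro tendsto_add lim UV)
    then show "\<mu> (U \<union> V) = \<mu> U + \<mu> V"
      using lim[OF compact_opens_Zp_Un[OF UV(1,2)]] LIMSEQ_unique by blast
  next
    fix n a :: nat assume na: "0 < n" "a < p ^ n"
    show "(\<lambda>m. 1 / qnum q (of_nat (p ^ m)) * (\<Sum>x<p ^ (m - n). f (of_nat (a + p ^ n * x))))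
        \<longlonglongrightarrow> \<mu> (coset_Zp p (of_nat a) n)"
      by (rule Lim_transform_eventually[OF lim[OF coset_Zp_compact_open[OF Zp_of_nat]] S_coset[OF na(2)]])
  qed
  then show "\<exists>\<mu>. is_mu_fq p q f \<mu>" by blast
next
  fix \<mu> \<nu> assume \<mu>: "is_mu_fq p q f \<mu>" and \<nu>: "is_mu_fq p q f \<nu>"
  show "\<mu> = \<nu>"
  proof (rule extensionalityI)
    show "\<mu> \<in> extensional compact_opens_Zp" "\<nu> \<in> extensional compact_opens_Zp"
      using \<mu> \<nu> by (auto simp: is_mu_fq_def distribution_Zp_def)
    fix U :: "'k set" assume "U \<in> compact_opens_Zp"
    then obtain n A where nA: "0 < n" "A \<subseteq> {..<p ^ n}" and U: "U = (\<Union>a\<in>A. coset_Zp p (of_nat a) n)"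
      by (rule compact_open_union_of_cosets)
    have "\<mu> (coset_Zp p (of_nat a) n) = \<nu> (coset_Zp p (of_nat a) n)" if "a \<in> A" for a
      using \<mu> \<nu> nA that unfolding is_mu_fq_def by (blast intro: LIMSEQ_unique)
    moreover have "distribution_Zp \<mu>" "distribution_Zp \<nu>" using \<mu> \<nu> by (auto simp: is_mu_fq_def)
    ultimately show "\<mu> U = \<nu> U"
      unfolding U using nA(2) by (simp add: distribution_union_of_cosets)
  qed
qed

section \<open>Geometric sums of principal units\<close>

text \<open>This form of \<open>|r - 1| < p^(-1/(p-1))\<close> avoids real exponents and is what the last binomial term
  \<open>(r - 1)^(p-1)\<close> in \<open>absval_sum_p_powers\<close> requires.\<close>

definition near_one :: "'k \<Rightarrow> bool" where
  "near_one r \<longleftrightarrow> absval (r - 1) ^ (p - 1) < 1 / real p"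

definition geo :: "'k \<Rightarrow> nat \<Rightarrow> 'k" where
  "geo r N = (\<Sum>x<p ^ N. r ^ x)"

lemma near_one_absval_less: "near_one r \<Longrightarrow> absval (r - 1) < 1"
  using inv_p_bounds one_le_power[of "absval (r - 1)" "p - 1"] unfolding near_one_def by linarith

lemma near_one_absval_le: "near_one r \<Longrightarrow> absval r \<le> 1"
  using near_one_absval_less[of r] absval_add_le[of "r - 1" 1 1] by simp

lemma absval_power_minus_1_le:
  fixes r :: 'k
  assumes "absval r \<le> 1"
  shows "absval (r ^ n - 1) \<le> absval (r - 1)"
proof -
  have "absval (\<Sum>i<n. r ^ i) \<le> 1"
    using assms by (intro absval_sum_le) (auto simp: absval_power power_le_one)
  then show ?thesis
    unfolding power_diff_1_eq mult.commute[of "r - 1"] by (rule absval_unit_mult_le) simp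
qed

lemma near_one_power:
  assumes "near_one r"
  shows "near_one (r ^ n)"
proof -
  have "absval (r ^ n - 1) ^ (p - 1) \<le> absval (r - 1) ^ (p - 1)"
    using absval_power_minus_1_le[OF near_one_absval_le[OF assms]] by (intro power_mono) auto
  then show ?thesis using assms unfolding near_one_def by linarith
qed

text \<open>With \<open>u = r - 1\<close> the sum is \<open>((1 + u)^p - 1)/u\<close>, the sum of \<open>p choose (i+1)\<close> times \<open>u^i\<close>. Its constant term \<open>p\<close>
  dominates: the middle terms are divisible by \<open>p\<close> and contain a factor \<open>u\<close>, and the last one is \<open>u^(p-1)\<close>.\<close>

lemma absval_sum_p_powers:
  assumes r: "near_one r"
  shows "absval (\<Sum>j<p. r ^ j) = 1 / real p"
proof (cases "r = 1")
  case True
  then show ?thesis by (simp add: absval_p)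
next
  case False
  define u where "u = r - 1"
  obtain p' where p': "p = Suc p'" using p_gt_1 by (cases p) auto
  have "r ^ p = (u + 1) ^ p" by (simp add: u_def)
  also have "\<dots> = (\<Sum>i\<le>Suc p'. of_nat (p choose i) * u ^ i)"
    by (subst binomial_ring) (simp add: p')
  also have "\<dots> = 1 + u * (\<Sum>i\<le>p'. of_nat (p choose Suc i) * u ^ i)"
    by (subst sum.atMost_Suc_shift) (simp add: sum_distrib_left algebra_simps)
  finally have "u * (\<Sum>j<p. r ^ j) = u * (\<Sum>i\<le>p'. of_nat (p choose Suc i) * u ^ i)"
    unfolding u_def power_diff_1_eq[symmetric] by simp
  then have "(\<Sum>j<p. r ^ j) = (\<Sum>i\<le>p'. of_nat (p choose Suc i) * u ^ i)"
    using False by (metis mult_left_cancel eq_iff_diff_eq_0 u_def)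
  also have "\<dots> = of_nat p + (\<Sum>i\<in>{..p'} - {0}. of_nat (p choose Suc i) * u ^ i)"
    by (subst sum.remove[of _ 0]) auto
  finally have eq: "(\<Sum>j<p. r ^ j) = of_nat p + (\<Sum>i\<in>{..p'} - {0}. of_nat (p choose Suc i) * u ^ i)" .
  have "absval (\<Sum>i\<in>{..p'} - {0}. of_nat (p choose Suc i) * u ^ i) < 1 / real p"
  proof (rule absval_sum_less)
    fix i assume i: "i \<in> {..p'} - {0}"
    show "absval (of_nat (p choose Suc i) * u ^ i) < 1 / real p"
    proof (cases "i = p'")
      case True
      then show ?thesis using r p' unfolding near_one_def u_def absval_power absval_mult by simp
    next
      case False
      then have "p dvd (p choose Suc i)"
        using i p' prime_p by (intro dvd_choose_prime) auto
      then have "absval (of_nat (p choose Suc i) :: 'k) \<le> 1 / real p"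
        using absval_of_nat_le_iff[of "p choose Suc i" 1] by (simp add: rad_def)
      moreover have "absval u ^ i < 1"
        using i near_one_absval_less[OF r] by (simp add: u_def power_less_one_iff)
      ultimately have "absval (of_nat (p choose Suc i) :: 'k) * absval u ^ i \<le> 1 / real p * absval u ^ i"
        and "1 / real p * absval u ^ i < 1 / real p * 1"
        using inv_p_bounds by (intro mult_right_mono mult_strict_left_mono; simp)+
      then show ?thesis by (simp add: absval_mult absval_power)
    qed
  qed (use inv_p_bounds in simp)
  then show ?thesis unfolding eq by (subst absval_add_dominant) (simp_all add: absval_p)
qed

lemma geo_add: "geo r (N + M) = geo r N * (\<Sum>y<p ^ M. (r ^ p ^ N) ^ y)"
  unfolding geo_def power_add sum_by_residue sum_product by (simp add: power_add power_mult)

lemma geo_Suc: "geo r (Suc N) = geo r N * (\<Sum>j<p. (r ^ p ^ N) ^ j)"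
  using geo_add[of r N 1] by simp

lemma absval_geo:
  assumes "near_one r"
  shows "absval (geo r N) = rad N"
proof (induction N)
  case 0
  then show ?case by (simp add: geo_def)
next
  case (Suc N)
  then show ?case
    using absval_sum_p_powers[OF near_one_power[OF assms]]
    by (simp add: geo_Suc absval_mult rad_Suc)
qed

lemma geo_nonzero: "near_one r \<Longrightarrow> geo r N \<noteq> 0"
  by (metis absval_geo absval_zero less_irrefl rad_pos)

lemma absval_p_power_minus_1_le:
  assumes "near_one r"
  shows "absval (r ^ p ^ N - 1) \<le> rad N"
proof -
  have "absval (r ^ p ^ N - 1) = absval (r - 1) * rad N"
    using power_diff_1_eq[of r "p ^ N"] absval_geo[OF assms, of N] by (simp add: geo_def absval_mult)
  then show ?thesis using near_one_absval_less[OF assms] by (simp add: mult_left_le_one_le)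
qed

section \<open>Integer powers extended to \<open>p\<close>-adic exponents\<close>

text \<open>The recursion \<open>(n + 1) (x choose (n+1)) = (x - n) (x choose n)\<close> exhibits a polynomial in \<open>x\<close>.\<close>

lemma continuous_on_gbinomial: "continuous_on S (\<lambda>x::'k. x gchoose n)"
proof (induction n)
  case (Suc n)
  have "(x gchoose Suc n) = (x - of_nat n) * (x gchoose n) * inverse (of_nat (Suc n))" for x :: 'k
    using gbinomial_mult_1[of x n] by (simp add: field_simps del: of_nat_Suc)
  then show ?case
    using Suc by (auto intro!: continuous_on_mult_ultrametric continuous_on_diff continuous_on_const continuous_on_id)
qed simp

lemma absval_gbinomial_le_1:
  assumes "(x::'k) \<in> Zp"
  shows "absval (x gchoose n) \<le> 1"
  by (rule Zp_absval_boundI[OF continuous_on_gbinomial _ assms]) (simp flip: binomial_gbinomial)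

lemma absval_qpow_term_le:
  assumes "(x::'k) \<in> Zp"
  shows "absval ((x gchoose n) * (q - 1) ^ n) \<le> absval (q - 1) ^ n"
  using absval_unit_mult_le[OF absval_gbinomial_le_1[OF assms] order_refl, of n "(q - 1) ^ n"]
  by (simp add: absval_power)

lemma qpow_term_bound_tendsto_0:
  assumes "near_one q"
  shows "(\<lambda>n. absval (q - 1) ^ n) \<longlonglongrightarrow> 0"
  using near_one_absval_less[OF assms] by (intro LIMSEQ_realpow_zero) auto

lemma continuous_on_qpow:
  assumes "near_one q"
  shows "continuous_on Zp (qpow q)"
  unfolding qpow_def[abs_def]
  by (rule ultrametric_suminf_continuous[OF _ absval_qpow_term_le qpow_term_bound_tendsto_0[OF assms]])
    (intro continuous_on_mult_ultrametric continuous_on_gbinomial continuous_on_const)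

lemma qpow_add:
  assumes q: "near_one q" and xy: "x \<in> Zp" "y \<in> Zp"
  shows "qpow q (x + y) = qpow q x * qpow q y"
proof -
  have shift: "continuous_on Zp (\<lambda>x. qpow q (x + y))" if "y \<in> Zp" for y
    by (rule continuous_on_compose2[OF continuous_on_qpow[OF q]])
      (use that in \<open>auto intro!: continuous_intros\<close>)
  have mult: "continuous_on Zp (\<lambda>x. qpow q x * c)" for c
    by (intro continuous_on_mult_ultrametric continuous_on_qpow q continuous_on_const)
  have nat: "qpow q (x + of_nat m) = qpow q x * qpow q (of_nat m)" if "x \<in> Zp" for x m
  proof (rule Zp_eqI[OF shift mult _ that])
    fix n
    show "qpow q (of_nat n + of_nat m) = qpow q (of_nat n) * qpow q (of_nat m)"
      using qpow_of_nat[of q "n + m"] by (simp add: qpow_of_nat power_add)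
  qed simp
  have "qpow q (y + x) = qpow q y * qpow q x"
  proof (rule Zp_eqI[OF shift mult _ xy(2)])
    fix n
    show "qpow q (of_nat n + x) = qpow q (of_nat n) * qpow q x"
      using nat[OF xy(1), of n] by (simp add: ac_simps)
  qed (rule xy)
  then show ?thesis by (simp add: ac_simps)
qed

lemma qpow_uminus_of_nat:
  assumes q: "near_one q"
  shows "qpow q (- of_nat x) * q ^ x = 1"
  using qpow_add[OF q Zp_uminus[OF Zp_of_nat] Zp_of_nat, of x x] qpow_of_nat[of q 0] qpow_of_nat[of q x] by simp

text \<open>Because \<open>q^(x+m) - q^x = q^x (q^m - 1)\<close>, it suffices to extend \<open>(q^m - 1)/m\<close> continuously to \<open>m = 0\<close>.
  Absorption, \<open>(m choose n) = (m/n) ((m-1) choose (n-1))\<close>, divides the binomial series by \<open>m\<close> term by term.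
  The new denominators cost at most a factor \<open>n\<close>, since \<open>|1/n| \<le> n\<close>, which the geometric decay of
  \<open>|q - 1|^n\<close> absorbs.\<close>

lemma qpow_C1_Zp:
  assumes q: "near_one q"
  shows "qpow q \<in> C1_Zp"
proof -
  let ?l = "absval (q - 1)"
  define t where "t n m = ((m - 1) gchoose n) * ((q - 1) ^ Suc n / of_nat (Suc n))" for n and m :: 'k
  define L where "L m = (\<Sum>n. t n m)" for m
  have bound: "absval (t n m) \<le> real (Suc n) * ?l ^ Suc n" if "m \<in> Zp" for n m
    unfolding t_def
  proof (rule absval_unit_mult_le)
    show "absval (m - 1 gchoose n) \<le> 1" using that by (intro absval_gbinomial_le_1) simp
    have "1 / absval (of_nat (Suc n) :: 'k) \<le> real (Suc n)"
      using absval_of_nat_ge[of "Suc n"] by (simp add: field_simps del: of_nat_Suc)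
    then have "?l ^ Suc n * (1 / absval (of_nat (Suc n) :: 'k)) \<le> ?l ^ Suc n * real (Suc n)"
      by (intro mult_left_mono) auto
    then show "absval ((q - 1) ^ Suc n / of_nat (Suc n)) \<le> real (Suc n) * ?l ^ Suc n"
      unfolding absval_divide absval_power by (simp add: mult.commute del: of_nat_Suc power_Suc)
  qed
  have null: "(\<lambda>n. real (Suc n) * ?l ^ Suc n) \<longlonglongrightarrow> 0"
    using near_one_absval_less[OF q] by (intro LIMSEQ_Suc powser_times_n_limit_0) simp
  have "continuous_on Zp L"
    unfolding L_def t_def[abs_def]
  proof (rule ultrametric_suminf_continuous[OF _ bound[unfolded t_def] null])
    show "continuous_on Zp (\<lambda>m. (m - 1 gchoose n) * ((q - 1) ^ Suc n / of_nat (Suc n)))" for n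
      by (intro continuous_on_mult_ultrametric continuous_on_const continuous_on_compose2[OF continuous_on_gbinomial[of UNIV]])
        (auto intro!: continuous_intros)
  qed
  then have "continuous_on (Zp \<times> Zp) (\<lambda>z. L (fst z))"
    by (rule continuous_on_compose2) (auto intro!: continuous_intros)
  moreover have "continuous_on (Zp \<times> Zp) (\<lambda>z. qpow q (snd z))"
    by (rule continuous_on_compose2[OF continuous_on_qpow[OF q]]) (auto intro!: continuous_intros)
  ultimately have cont: "continuous_on (Zp \<times> Zp) (\<lambda>z. qpow q (snd z) * L (fst z))"
    by (intro continuous_on_mult_ultrametric)
  have L: "qpow q m - 1 = m * L m" if m: "m \<in> Zp" for m
  proof -
    have "summable (\<lambda>n. (m gchoose n) * (q - 1) ^ n)"
      by (rule ultrametric_summable[OF absval_qpow_term_le[OF m] qpow_term_bound_tendsto_0[OF q]])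
    then have "(\<lambda>N. \<Sum>n<Suc N. (m gchoose n) * (q - 1) ^ n) \<longlonglongrightarrow> qpow q m"
      unfolding qpow_def by (intro LIMSEQ_Suc summable_LIMSEQ)
    moreover have "(\<Sum>n<Suc N. (m gchoose n) * (q - 1) ^ n) = 1 + m * (\<Sum>n<N. t n m)" for N
    proof -
      have "(m gchoose Suc n) * (q - 1) ^ Suc n = m * t n m" for n
        unfolding t_def by (subst gbinomial_absorption') simp_all
      then show ?thesis
        by (subst sum.lessThan_Suc_shift) (simp add: sum_distrib_left)
    qed
    moreover have "(\<lambda>N. 1 + m * (\<Sum>n<N. t n m)) \<longlonglongrightarrow> 1 + m * L m"
      unfolding L_def
      by (intro tendsto_intros summable_LIMSEQ ultrametric_summable[OF bound[OF m] null])
    ultimately have "qpow q m = 1 + m * L m" using LIMSEQ_unique by simp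
    then show ?thesis by simp
  qed
  show ?thesis
  proof (rule C1_ZpI[OF cont])
    fix m x :: 'k assume mx: "m \<in> Zp" "x \<in> Zp"
    have "qpow q (x + m) - qpow q x = qpow q x * (qpow q m - 1)"
      using qpow_add[OF q mx(2,1)] by (simp add: algebra_simps)
    then show "qpow q (x + m) - qpow q x = m * (qpow q (snd (m, x)) * L (fst (m, x)))"
      using L[OF mx(1)] by (simp add: ac_simps)
  qed
qed

section \<open>Comparing geometric sums with \<open>[p^N]_q\<close>\<close>

definition ratio :: "'k \<Rightarrow> nat \<Rightarrow> nat \<Rightarrow> 'k" where
  "ratio q k N = geo (q ^ k) N / geo q N"

definition ratio_limit :: "'k \<Rightarrow> nat \<Rightarrow> 'k" where
  "ratio_limit q k = lim (ratio q k)"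

lemma qnum_p_power:
  assumes "q \<noteq> 1"
  shows "qnum q (of_nat (p ^ N)) = geo q N"
  using assms unfolding qnum_def qpow_of_nat geo_def by (simp add: one_diff_power_eq)

lemma absval_ratio: "near_one q \<Longrightarrow> absval (ratio q k N) = 1"
  by (simp add: ratio_def absval_divide absval_geo near_one_power order_less_imp_not_eq2)

text \<open>Both geometric sums are multiplied by a sum with \<open>p\<close> summands when \<open>N\<close> increases by 1. All these summands are
  within \<open>p^(-N)\<close> of 1, and dividing by a number of absolute value \<open>1/p\<close> accounts for the factor \<open>p\<close>.\<close>

lemma ratio_step:
  assumes q: "near_one q"
  shows "absval (ratio q k (Suc N) - ratio q k N) \<le> real p * rad N"
proof -
  let ?A = "\<lambda>r. \<Sum>j<p. ((r::'k) ^ p ^ N) ^ j"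
  have A1: "absval (?A q) = 1 / real p"
    by (intro absval_sum_p_powers near_one_power q)
  then have nz: "?A q \<noteq> 0" "geo q N \<noteq> 0" using p_gt_1 geo_nonzero[OF q] by force+
  have near: "absval (r ^ j - 1) \<le> rad N" if "absval (r - 1) \<le> rad N" "absval r \<le> 1" for r :: 'k and j
    using absval_power_minus_1_le[OF that(2)] that(1) by (rule order_trans)
  have "absval (?A (q ^ k) - ?A q) \<le> rad N"
    unfolding sum_subtractf[symmetric]
  proof (rule absval_sum_le)
    fix j
    have "absval (((q ^ k) ^ p ^ N) ^ j - 1) \<le> rad N" "absval ((q ^ p ^ N) ^ j - 1) \<le> rad N"
      by (intro near absval_p_power_minus_1_le near_one_absval_le near_one_power q)+
    from absval_diff_le[OF this]
    show "absval (((q ^ k) ^ p ^ N) ^ j - (q ^ p ^ N) ^ j) \<le> rad N" by simp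
  qed simp
  moreover have "ratio q k (Suc N) - ratio q k N = ratio q k N * ((?A (q ^ k) - ?A q) / ?A q)"
    using nz by (simp add: ratio_def geo_Suc field_simps)
  then have "absval (ratio q k (Suc N) - ratio q k N) = absval (?A (q ^ k) - ?A q) * real p"
    by (simp add: absval_mult absval_divide absval_ratio[OF q] A1)
  ultimately show ?thesis by (simp add: mult.commute mult_left_mono)
qed

lemma ratio_tendsto:
  assumes q: "near_one q"
  shows "ratio q k \<longlonglongrightarrow> ratio_limit q k"
proof -
  have "(\<lambda>N. real p * rad N) \<longlonglongrightarrow> 0" by (intro tendsto_mult_right_zero rad_tendsto_0)
  then show ?thesis
    unfolding ratio_limit_def convergent_LIMSEQ_iff[symmetric]
    by (rule convergent_if_differences_vanish[of "ratio q k", OF ratio_step[OF q]])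
qed

lemma ratio_limit_estimate:
  assumes q: "near_one q"
  shows "absval (ratio_limit q k / ratio q k N - 1) \<le> real p * rad N"
proof -
  have "absval (ratio_limit q k - ratio q k N) \<le> real p * rad N"
    by (rule LIMSEQ_le_absval_diff[of "ratio q k", OF ratio_step[OF q] _ _ ratio_tendsto[OF q]])
      (auto simp: decseq_def rad_mono mult_left_mono)
  moreover have "ratio q k N \<noteq> 0" using absval_ratio[OF q, of k N] by auto
  then have "ratio_limit q k / ratio q k N - 1 = (ratio_limit q k - ratio q k N) / ratio q k N"
    by (simp add: field_simps)
  ultimately show ?thesis by (simp add: absval_divide absval_ratio[OF q])
qed

text \<open>The sum for \<open>k = 0\<close> is \<open>p^N\<close>, so \<open>ratio q 0\<close> converts the average with weight \<open>1/p^N\<close> into the one with weight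
  \<open>1/[p^N]_q\<close>.\<close>

lemma qVolkenborn_convergent:
  assumes q: "near_one q" and G: "G \<in> C1_Zp"
  shows "convergent (\<lambda>N. 1 / geo q N * (\<Sum>x<p ^ N. G (of_nat x)))"
proof -
  obtain V where "(\<lambda>N. 1 / of_nat (p ^ N) * (\<Sum>x<p ^ N. G (of_nat x))) \<longlonglongrightarrow> V"
    using Volkenborn_convergent[OF G] unfolding convergent_def by blast
  then have "(\<lambda>N. ratio q 0 N * (1 / of_nat (p ^ N) * (\<Sum>x<p ^ N. G (of_nat x)))) \<longlonglongrightarrow> ratio_limit q 0 * V"
    by (intro tendsto_mult ratio_tendsto q)
  moreover have "ratio q 0 N * (1 / of_nat (p ^ N) * s) = 1 / geo q N * s" for N s
    using p_gt_1 by (simp add: ratio_def geo_def)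
  ultimately show ?thesis by (simp only:) (rule convergentI)
qed

section \<open>The distribution attached to a polynomial in \<open>q\<^sup>x\<close>\<close>

text \<open>Splitting \<open>\<Sum>x<p^m. q^(k x)\<close> by residues modulo \<open>p^n\<close> shows that the sum over one residue class is
  \<open>q^(k a)\<close> times a quotient of two full geometric sums.\<close>

lemma coset_sum_tendsto:
  fixes f :: "'k \<Rightarrow> 'k"
  assumes q: "near_one q" "q \<noteq> 1" and f: "\<And>x. f (of_nat x) = (\<Sum>k\<le>d. c k * (q ^ k) ^ x)"
  shows "(\<lambda>m. 1 / qnum q (of_nat (p ^ m)) * (\<Sum>x<p ^ (m - n). f (of_nat (a + p ^ n * x))))
    \<longlonglongrightarrow> (\<Sum>k\<le>d. c k * (q ^ k) ^ a * (ratio_limit q k / geo (q ^ k) n))"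
proof (rule Lim_transform_eventually)
  show "(\<lambda>m. \<Sum>k\<le>d. c k * (q ^ k) ^ a * (ratio q k m * (1 / geo (q ^ k) n)))
    \<longlonglongrightarrow> (\<Sum>k\<le>d. c k * (q ^ k) ^ a * (ratio_limit q k / geo (q ^ k) n))"
    unfolding divide_inverse mult_1_left by (intro tendsto_intros ratio_tendsto q)
  show "\<forall>\<^sub>F m in sequentially. (\<Sum>k\<le>d. c k * (q ^ k) ^ a * (ratio q k m * (1 / geo (q ^ k) n)))
    = 1 / qnum q (of_nat (p ^ m)) * (\<Sum>x<p ^ (m - n). f (of_nat (a + p ^ n * x)))"
    using eventually_ge_at_top[of n]
  proof eventually_elim
    case (elim m)
    have "(\<Sum>x<p ^ (m - n). (q ^ k) ^ (a + p ^ n * x)) = (q ^ k) ^ a * (geo (q ^ k) m / geo (q ^ k) n)" for k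
    proof -
      have "geo (q ^ k) m = geo (q ^ k) n * (\<Sum>x<p ^ (m - n). ((q ^ k) ^ p ^ n) ^ x)"
        using geo_add[of "q ^ k" n "m - n"] elim by simp
      then show ?thesis
        using geo_nonzero[OF near_one_power[OF q(1)], of k n]
        by (simp add: power_add power_mult flip: sum_distrib_left)
    qed
    then have "(\<Sum>x<p ^ (m - n). f (of_nat (a + p ^ n * x)))
        = (\<Sum>k\<le>d. c k * ((q ^ k) ^ a * (geo (q ^ k) m / geo (q ^ k) n)))"
      unfolding f by (subst sum.swap) (simp only: sum_distrib_left[symmetric])
    then show ?case
      unfolding qnum_p_power[OF q(2)] ratio_def by (simp add: sum_distrib_left ac_simps)
  qed
qed

lemma is_mu_fq_exponential_polynomial:
  fixes f :: "'k \<Rightarrow> 'k"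
  assumes "near_one q" "q \<noteq> 1" "\<And>x. f (of_nat x) = (\<Sum>k\<le>d. c k * (q ^ k) ^ x)"
  shows "\<exists>!\<mu>. is_mu_fq p q f \<mu>"
  using coset_sum_tendsto[OF assms] by (intro is_mu_fq_ex1 convergentI)

text \<open>The factor \<open>1/[p^n]_q\<close> is pulled out because the remaining quotient is \<open>1 + O(p^(-n))\<close>.\<close>

lemma mu_fq_coset:
  fixes f :: "'k \<Rightarrow> 'k"
  assumes q: "near_one q" "q \<noteq> 1" and f: "\<And>x. f (of_nat x) = (\<Sum>k\<le>d. c k * (q ^ k) ^ x)"
    and \<mu>: "is_mu_fq p q f \<mu>" and n: "0 < n" "a < p ^ n"
  shows "\<mu> (coset_Zp p (of_nat a) n)
    = 1 / geo q n * (\<Sum>k\<le>d. c k * (q ^ k) ^ a * (ratio_limit q k / ratio q k n))"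
proof -
  have "\<mu> (coset_Zp p (of_nat a) n) = (\<Sum>k\<le>d. c k * (q ^ k) ^ a * (ratio_limit q k / geo (q ^ k) n))"
    using \<mu> n coset_sum_tendsto[OF q f] unfolding is_mu_fq_def by (blast intro: LIMSEQ_unique)
  also have "\<dots> = 1 / geo q n * (\<Sum>k\<le>d. c k * (q ^ k) ^ a * (ratio_limit q k / ratio q k n))"
    using geo_nonzero[OF q(1)] by (simp add: ratio_def sum_distrib_left ac_simps)
  finally show ?thesis .
qed

text \<open>The coset of \<open>x\<close> is that of a natural number \<open>a\<close> with \<open>|x - a| \<le> p^(-n)\<close>, for which the explicit value
  is available. The Lipschitz bound pays for exchanging \<open>f(a)\<close> and \<open>f(x)\<close>.\<close>

lemma mu_fq_density_estimate:
  fixes f :: "'k \<Rightarrow> 'k"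
  assumes q: "near_one q" "q \<noteq> 1" and f: "\<And>x. f (of_nat x) = (\<Sum>k\<le>d. c k * (q ^ k) ^ x)"
    and C1: "f \<in> C1_Zp" and \<mu>: "is_mu_fq p q f \<mu>"
  obtains C where "0 < C" "\<And>n x. 0 < n \<Longrightarrow> x \<in> Zp \<Longrightarrow>
    absval (qnum q (of_nat (p ^ n)) * \<mu> (coset_Zp p x n) - f x) \<le> C * rad n"
proof -
  obtain B where B: "0 < B" "\<And>x y. x \<in> Zp \<Longrightarrow> y \<in> Zp \<Longrightarrow> absval (f x - f y) \<le> B * absval (x - y)"
    using C1_Zp_Lipschitz[OF C1] by blast
  define D where "D = (\<Sum>k\<le>d. absval (c k)) * real p"
  have D: "0 \<le> D" by (simp add: D_def sum_nonneg)
  have "absval (qnum q (of_nat (p ^ n)) * \<mu> (coset_Zp p x n) - f x) \<le> (B + D) * rad n"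
    if n: "0 < n" and x: "x \<in> Zp" for n x
  proof -
    obtain a where a: "a < p ^ n" "absval (x - of_nat a) \<le> rad n" using Zp_residue[OF x] by blast
    have coset: "coset_Zp p x n = coset_Zp p (of_nat a) n" by (rule coset_Zp_cong[OF x _ a(2)]) simp
    have "qnum q (of_nat (p ^ n)) * \<mu> (coset_Zp p x n) - f (of_nat a)
        = (\<Sum>k\<le>d. (q ^ k) ^ a * (c k * (ratio_limit q k / ratio q k n - 1)))"
      unfolding coset qnum_p_power[OF q(2)] mu_fq_coset[OF q f \<mu> n a(1)] f
      using geo_nonzero[OF q(1)] by (simp add: sum_subtractf[symmetric] algebra_simps)
    also have "absval \<dots> \<le> (\<Sum>k\<le>d. absval ((q ^ k) ^ a * (c k * (ratio_limit q k / ratio q k n - 1))))"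
      by (rule absval_sum_triangle)
    also have "\<dots> \<le> (\<Sum>k\<le>d. absval (c k) * (real p * rad n))"
    proof (rule sum_mono, rule absval_unit_mult_le)
      fix k
      show "absval ((q ^ k) ^ a) \<le> 1" by (intro near_one_absval_le near_one_power q)
      show "absval (c k * (ratio_limit q k / ratio q k n - 1)) \<le> absval (c k) * (real p * rad n)"
        unfolding absval_mult using ratio_limit_estimate[OF q(1)] by (intro mult_left_mono) auto
    qed
    also have "\<dots> = D * rad n" by (simp add: D_def sum_distrib_right mult.assoc)
    finally have 1: "absval (qnum q (of_nat (p ^ n)) * \<mu> (coset_Zp p x n) - f (of_nat a)) \<le> D * rad n" .
    have "absval (f (of_nat a) - f x) \<le> B * absval (x - of_nat a)"
      using B(2)[of x "of_nat a"] x by (simp add: absval_minus_commute)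
    also have "\<dots> \<le> B * rad n" using a B by (intro mult_left_mono) auto
    finally have 2: "absval (f (of_nat a) - f x) \<le> B * rad n" .
    show ?thesis
      using absval_triangle[of "qnum q (of_nat (p ^ n)) * \<mu> (coset_Zp p x n) - f (of_nat a)" "f (of_nat a) - f x"] 1 2
      by (simp add: distrib_right)
  qed
  then show thesis using that[of "B + D"] B D by simp
qed

lemma strongly_q_invariantI:
  assumes \<mu>: "distribution_Zp \<mu>" and C: "0 < C"
    and est: "\<And>n x. 0 < n \<Longrightarrow> x \<in> Zp \<Longrightarrow>
      absval (qnum q (of_nat (p ^ n)) * \<mu> (coset_Zp p x n) - f x) \<le> C * rad n"
  shows "strongly_q_invariant p (q :: 'k) \<mu>"
  unfolding strongly_q_invariant_def
proof (intro conjI \<mu> exI[of _ C] C allI impI)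
  fix a :: int and n :: nat assume n: "0 < n"
  have "absval (qnum q (of_nat (p ^ (n + 1))) * \<mu> (coset_Zp p (of_int a) (n + 1)) - f (of_int a)) \<le> C * rad (n + 1)"
    by (rule est) auto
  also have "\<dots> \<le> C * rad n" using C by (intro mult_left_mono rad_mono) auto
  finally have "absval (f (of_int a) - qnum q (of_nat (p ^ (n + 1))) * \<mu> (coset_Zp p (of_int a) (n + 1))) \<le> C * rad n"
    by (simp add: absval_minus_commute)
  then have "absval (qnum q (of_nat (p ^ n)) * \<mu> (coset_Zp p (of_int a) n)
      - qnum q (of_nat (p ^ (n + 1))) * \<mu> (coset_Zp p (of_int a) (n + 1))) \<le> C * rad n"
    by (rule absval_diff_trans[OF est[OF n Zp_of_int]])
  also have "rad n = real p powr (- real n)"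
    using p_gt_1 by (simp add: rad_def powr_minus powr_realpow power_one_over inverse_eq_divide)
  finally show "absval (qnum q (of_nat (p ^ n)) * \<mu> (coset_Zp p (of_int a) n)
      - qnum q (of_nat (p ^ (n + 1))) * \<mu> (coset_Zp p (of_int a) (n + 1))) \<le> C * real p powr (- real n)" .
qed

lemma has_RN_derivativeI:
  assumes x: "x \<in> Zp"
    and est: "\<And>n x. 0 < n \<Longrightarrow> x \<in> Zp \<Longrightarrow>
      absval (qnum q (of_nat (p ^ n)) * \<mu> (coset_Zp p x n) - f x) \<le> C * rad n"
  shows "has_RN_derivative p (q :: 'k) \<mu> x (f x)"
  unfolding has_RN_derivative_def LIMSEQ_absval_iff
proof (rule tendsto_sandwich[OF _ _ tendsto_const])
  show "(\<lambda>n. C * rad n) \<longlonglongrightarrow> 0" by (intro tendsto_mult_right_zero rad_tendsto_0)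
  show "\<forall>\<^sub>F n in sequentially. absval (qnum q (of_nat (p ^ n)) * \<mu> (coset_Zp p x n) - f x) \<le> C * rad n"
    using eventually_gt_at_top[of 0] by eventually_elim (rule est[OF _ x])
qed simp

text \<open>Each exponential \<open>q^(k x)\<close> contributes the same average \<open>V k N\<close> to both approximating sums, in one of them
  multiplied by a factor tending to 1. On the other side \<open>q^(-x) q^x = 1\<close> removes the density of
  \<open>\<mu>\<^sub>q\<close>.\<close>

lemma mu_fq_integral:
  fixes f g :: "'k \<Rightarrow> 'k"
  assumes q: "near_one q" "q \<noteq> 1" and f: "\<And>x. f (of_nat x) = (\<Sum>k\<le>d. c k * (q ^ k) ^ x)"
    and C1: "f \<in> C1_Zp" and \<mu>: "is_mu_fq p q f \<mu>" and g: "g \<in> C1_Zp"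
  shows "\<exists>I. has_distr_integral p \<mu> g I \<and> has_qVolkenborn_integral p q (\<lambda>x. g x * f x * qpow q (- x)) I"
proof -
  define V where "V k N = 1 / geo q N * (\<Sum>x<p ^ N. g (of_nat x) * (q ^ k) ^ x)" for k N
  have "convergent (V k)" for k
  proof -
    have "(\<lambda>x. g x * qpow q x ^ k) \<in> C1_Zp" by (intro C1_Zp_mult C1_Zp_power qpow_C1_Zp g q)
    from qVolkenborn_convergent[OF q(1) this] show ?thesis
      unfolding V_def[abs_def] qpow_of_nat by (simp add: power_mult[symmetric] mult.commute)
  qed
  then have V: "V k \<longlonglongrightarrow> lim (V k)" for k by (simp add: convergent_LIMSEQ_iff)
  define I where "I = (\<Sum>k\<le>d. c k * lim (V k))"
  have "has_distr_integral p \<mu> g I"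
    unfolding has_distr_integral_def
  proof (rule Lim_transform_eventually)
    have "(\<lambda>N. ratio_limit q k / ratio q k N) \<longlonglongrightarrow> 1" for k
      unfolding LIMSEQ_absval_iff
    proof (rule tendsto_sandwich[OF _ _ tendsto_const])
      show "(\<lambda>n. real p * rad n) \<longlonglongrightarrow> 0" by (intro tendsto_mult_right_zero rad_tendsto_0)
    qed (simp_all add: ratio_limit_estimate[OF q(1)])
    then have "(\<lambda>N. \<Sum>k\<le>d. c k * (V k N * (ratio_limit q k / ratio q k N))) \<longlonglongrightarrow> (\<Sum>k\<le>d. c k * (lim (V k) * 1))"
      by (intro tendsto_sum tendsto_mult tendsto_const V)
    then show "(\<lambda>N. \<Sum>k\<le>d. c k * (V k N * (ratio_limit q k / ratio q k N))) \<longlonglongrightarrow> I" by (simp add: I_def)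
    show "\<forall>\<^sub>F N in sequentially. (\<Sum>k\<le>d. c k * (V k N * (ratio_limit q k / ratio q k N)))
        = (\<Sum>x<p ^ N. g (of_nat x) * \<mu> (coset_Zp p (of_nat x) N))"
      using eventually_gt_at_top[of 0]
    proof eventually_elim
      case (elim N)
      have "(\<Sum>x<p ^ N. g (of_nat x) * \<mu> (coset_Zp p (of_nat x) N))
          = (\<Sum>x<p ^ N. \<Sum>k\<le>d. c k * (1 / geo q N * (g (of_nat x) * (q ^ k) ^ x) * (ratio_limit q k / ratio q k N)))"
        by (intro sum.cong refl) (simp add: mu_fq_coset[OF q f \<mu> elim] sum_distrib_left ac_simps)
      also have "\<dots> = (\<Sum>k\<le>d. c k * (V k N * (ratio_limit q k / ratio q k N)))"
        unfolding V_def by (subst sum.swap) (simp add: sum_distrib_left sum_distrib_right sum_divide_distrib)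
      finally show ?case ..
    qed
  qed
  moreover have "has_qVolkenborn_integral p q (\<lambda>x. g x * f x * qpow q (- x)) I"
    unfolding has_qVolkenborn_integral_def
  proof
    show "(\<lambda>x. g x * f x * qpow q (- x)) \<in> C1_Zp"
      by (intro C1_Zp_mult C1_Zp_reflect qpow_C1_Zp g C1 q)
    have "1 / qnum q (of_nat (p ^ N)) * (\<Sum>x<p ^ N. g (of_nat x) * f (of_nat x) * qpow q (- of_nat x) * q ^ x)
        = (\<Sum>k\<le>d. c k * V k N)" for N
    proof -
      have "(\<Sum>x<p ^ N. g (of_nat x) * f (of_nat x) * qpow q (- of_nat x) * q ^ x)
          = (\<Sum>x<p ^ N. \<Sum>k\<le>d. c k * (g (of_nat x) * (q ^ k) ^ x))"
        by (simp add: mult.assoc qpow_uminus_of_nat[OF q(1)] f sum_distrib_left mult.left_commute)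
      then show ?thesis
        unfolding qnum_p_power[OF q(2)] V_def by (subst (asm) sum.swap) (simp add: sum_distrib_left ac_simps)
    qed
    moreover have "(\<lambda>N. \<Sum>k\<le>d. c k * V k N) \<longlonglongrightarrow> I"
      unfolding I_def by (intro tendsto_intros V)
    ultimately show "(\<lambda>N. 1 / qnum q (of_nat (p ^ N))
        * (\<Sum>x<p ^ N. g (of_nat x) * f (of_nat x) * qpow q (- of_nat x) * q ^ x)) \<longlonglongrightarrow> I" by simp
  qed
  ultimately show ?thesis by blast
qed

lemma near_one_if_absval_less:
  assumes "absval (1 - q) < real p powr (- 1 / (real p - 1))"
  shows "near_one q"
proof -
  have "absval (q - 1) ^ (p - 1) < (real p powr (- 1 / (real p - 1))) ^ (p - 1)"
    using assms p_gt_1 by (intro power_strict_mono) (auto simp: absval_minus_commute)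
  also have "\<dots> = real p powr (- 1 / (real p - 1) * real (p - 1))"
    using p_gt_1 by (simp add: powr_realpow[symmetric] powr_powr)
  also have "- 1 / (real p - 1) * real (p - 1) = - 1"
    using p_gt_1 by (simp add: of_nat_diff field_simps)
  finally show ?thesis
    unfolding near_one_def by (simp add: powr_minus inverse_eq_divide)
qed

end

theorem theorem3:
  fixes p :: nat
    and q :: "'k::{ultrametric_field, complete_space}"
    and R :: "'k poly"
    and P :: "'k \<Rightarrow> 'k"
  assumes "prime p"
    and "is_Cp p TYPE('k)"
    and "q \<noteq> 1"
    and "absval (1 - q) < real p powr (- 1 / (real p - 1))"
    and P_def: "P = (\<lambda>x. poly R (qnum q x))"
  shows "(\<exists>!\<mu>. is_mu_fq p q P \<mu>) \<and>
    strongly_q_invariant p q (mu_fq p q P) \<and>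
    (\<forall>x\<in>Zp. has_RN_derivative p q (mu_fq p q P) x (P x)) \<and>
    (\<forall>g\<in>C1_Zp. \<exists>I.
       has_distr_integral p (mu_fq p q P) g I \<and>
       has_qVolkenborn_integral p q (\<lambda>x. g x * P x * qpow q (- x)) I)"
proof -
  interpret padic p "TYPE('k)"
    using assms(1,2) by unfold_locales (simp add: is_padic_field_def is_Cp_def)
  note q = near_one_if_absval_less[OF assms(4)] assms(3)
  define S where "S = pcompose R [:1 / (1 - q), - 1 / (1 - q):]"
  have P_qpow: "P x = poly S (qpow q x)" for x
    by (simp add: P_def S_def poly_pcompose qnum_def diff_divide_distrib)
  then have "P = (\<lambda>x. poly S (qpow q x))" by blast
  then have C1: "P \<in> C1_Zp" using C1_Zp_poly[OF qpow_C1_Zp[OF q(1)], of S] by simp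
  have P_nat: "P (of_nat x) = (\<Sum>k\<le>degree S. coeff S k * (q ^ k) ^ x)" for x
    by (simp add: P_qpow qpow_of_nat poly_altdef power_mult[symmetric] mult.commute)
  have ex1: "\<exists>!\<mu>. is_mu_fq p q P \<mu>" by (rule is_mu_fq_exponential_polynomial[OF q P_nat])
  then have \<mu>: "is_mu_fq p q P (mu_fq p q P)" unfolding mu_fq_def by (rule theI')
  obtain C where C: "0 < C" and est: "\<And>n x. 0 < n \<Longrightarrow> x \<in> Zp \<Longrightarrow>
      absval (qnum q (of_nat (p ^ n)) * mu_fq p q P (coset_Zp p x n) - P x) \<le> C * rad n"
    using mu_fq_density_estimate[OF q P_nat C1 \<mu>] by blast
  have "distribution_Zp (mu_fq p q P)" using \<mu> by (simp add: is_mu_fq_def)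
  then have "strongly_q_invariant p q (mu_fq p q P)" using C est by (rule strongly_q_invariantI)
  moreover have "\<forall>x\<in>Zp. has_RN_derivative p q (mu_fq p q P) x (P x)"
    using has_RN_derivativeI est by blast
  moreover have "\<forall>g\<in>C1_Zp. \<exists>I. has_distr_integral p (mu_fq p q P) g I \<and>
      has_qVolkenborn_integral p q (\<lambda>x. g x * P x * qpow q (- x)) I"
    using mu_fq_integral[OF q P_nat C1 \<mu>] by blast
  ultimately show ?thesis using ex1 by blast
qed

end
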